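(* Let $d$ be prime, $n\ge1$, $\rho$ an $n$-qudit state and $\alpha\ge 1$. Then $$\min_{\sigma\in \mathrm{MSPS}}D_\alpha(\rho\|\sigma)=D_\alpha(\rho\|\mathcal M(\rho))=H_\alpha(\mathcal M(\rho))-H_\alpha(\rho),$$ where the minimum is over all $n$-qudit MSPSs. Moreover $\mathcal M(\rho)$ is the unique minimizer: for every MSPS $\sigma\neq\mathcal M(\rho)$, $D_\alpha(\rho\|\sigma)>D_\alpha(\rho\|\mathcal M(\rho))$.
   Context: Fix a prime $d$ and $n\ge1$. Let $\mathcal H=\mathbb C^d$ with computational basis $\{|k\rangle\}_{k\in\mathbb Z_d}$, $\chi(k)=e^{2\pi i k/d}$, $X|k\rangle=|k+1\rangle$, $Z|k\rangle=\chi(k)|k\rangle$. For $(p,q)\in\mathbb Z_d^2$ the Weyl operator is $w(p,q)=\chi(-2^{-1}pq)Z^pX^q$ if $d$ is odd and $w(p,q)=i^{-pq}Z^pX^q$ if $d=2$. Let $V^n=\mathbb Z_d^n\times\mathbb Z_d^n$ and $w(\vec p,\vec q)=\bigotimes_{k}w(p_k,q_k)$. The characteristic function of a state $\rho$ is $\Xi_\rho(\vec p,\vec q)=\mathrm{Tr}[\rho\,w(-\vec p,-\vec q)]$. For an abelian group $S$ of Weyl operators (up to phases), a minimal projection of the C*-algebra generated by $S$ divided by its rank is a minimal stabilizer-projection state (MSPS). The mean state $\mathcal M(\rho)$ is the operator with $\Xi_{\mathcal M(\rho)}(\vec x)=\Xi_\rho(\vec x)$ if $|\Xi_\rho(\vec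 x)|=1$ and $0$ otherwise. The sandwiched quantum Rényi relative entropy is $D_\alpha(\rho\|\sigma)=\frac{1}{\alpha-1}\log\mathrm{Tr}\big[(\sigma^{\frac{1-\alpha}{2\alpha}}\rho\,\sigma^{\frac{1-\alpha}{2\alpha}})^\alpha\big]$ (with the usual limits at $\alpha=1,\infty$ and $+\infty$ if the support of $\rho$ is not contained in that of $\sigma$), and $H_\alpha(\rho)=\frac{1}{1-\alpha}\log\mathrm{Tr}\rho^\alpha$ (with limits at $\alpha=1,\infty$). *)

theory Defs
  imports Complex_Main "HOL-Library.Extended_Real"
    "Jordan_Normal_Form.Char_Poly" "Jordan_Normal_Form.Schur_Decomposition"
    "Jordan_Normal_Form.DL_Rank"
begin

definition chi :: "nat \<Rightarrow> int \<Rightarrow> complex" where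
  "chi d k = exp (2 * of_real pi * \<i> * of_int k / of_nat d)"

text \<open>Inverse of 2 modulo an odd d.\<close>
definition inv2 :: "nat \<Rightarrow> int" where
  "inv2 d = int ((d + 1) div 2)"

definition wphase :: "nat \<Rightarrow> nat \<Rightarrow> nat \<Rightarrow> complex" where
  "wphase d p q = (if d = 2 then (- \<i>) ^ (p * q) else chi d (- inv2 d * int p * int q))"

text \<open>Single-qudit Weyl operator w(p,q) = phase * Z^p X^q, as a d x d matrix in the
  computational basis: Z^p X^q |b> = chi(p (b+q)) |b+q>.\<close>
definition w1 :: "nat \<Rightarrow> nat \<Rightarrow> nat \<Rightarrow> complex mat" where
  "w1 d p q = mat d d (\<lambda>(a, b). if a = (b + q) mod d then wphase d p q * chi d (int (p * a)) else 0)"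

text \<open>The j-th qudit index (base-d digit) of a computational basis index of (C^d)^{\<otimes> n}.\<close>
definition digit :: "nat \<Rightarrow> nat \<Rightarrow> nat \<Rightarrow> nat" where
  "digit d i j = (i div d ^ j) mod d"

text \<open>n-qudit Weyl operator w(p,q) = tensor product of w(p_k,q_k), written entrywise.\<close>
definition weyl :: "nat \<Rightarrow> nat \<Rightarrow> (nat \<Rightarrow> nat) \<Rightarrow> (nat \<Rightarrow> nat) \<Rightarrow> complex mat" where
  "weyl d n p q = mat (d ^ n) (d ^ n)
     (\<lambda>(r, c). \<Prod>j<n. w1 d (p j) (q j) $$ (digit d r j, digit d c j))"

definition Vn :: "nat \<Rightarrow> nat \<Rightarrow> ((nat \<Rightarrow> nat) \<times> (nat \<Rightarrow> nat)) set" where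
  "Vn d n = {(p, q). \<forall>j. (j < n \<longrightarrow> p j < d \<and> q j < d) \<and> (n \<le> j \<longrightarrow> p j = 0 \<and> q j = 0)}"

definition vneg :: "nat \<Rightarrow> (nat \<Rightarrow> nat) \<Rightarrow> (nat \<Rightarrow> nat)" where
  "vneg d p = (\<lambda>j. (d - p j) mod d)"

definition vadd :: "nat \<Rightarrow> (nat \<Rightarrow> nat) \<times> (nat \<Rightarrow> nat) \<Rightarrow> (nat \<Rightarrow> nat) \<times> (nat \<Rightarrow> nat)
    \<Rightarrow> (nat \<Rightarrow> nat) \<times> (nat \<Rightarrow> nat)" where
  "vadd d x y = ((\<lambda>j. (fst x j + fst y j) mod d), (\<lambda>j. (snd x j + snd y j) mod d))"

definition Weyl :: "nat \<Rightarrow> nat \<Rightarrow> (nat \<Rightarrow> nat) \<times> (nat \<Rightarrow> nat) \<Rightarrow> complex mat" where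
  "Weyl d n x = weyl d n (fst x) (snd x)"

definition tr :: "complex mat \<Rightarrow> complex" where
  "tr A = (\<Sum>i<dim_row A. A $$ (i, i))"

definition hermitian :: "complex mat \<Rightarrow> bool" where
  "hermitian A \<longleftrightarrow> mat_adjoint A = A"

definition psd :: "nat \<Rightarrow> complex mat \<Rightarrow> bool" where
  "psd N A \<longleftrightarrow> A \<in> carrier_mat N N \<and> hermitian A \<and>
     (\<forall>v \<in> carrier_vec N. 0 \<le> Re (\<Sum>i<N. cnj (v $ i) * (A *\<^sub>v v) $ i))"

definition density :: "nat \<Rightarrow> complex mat \<Rightarrow> bool" where
  "density N A \<longleftrightarrow> psd N A \<and> tr A = 1"

definition charfun :: "nat \<Rightarrow> nat \<Rightarrow> complex mat \<Rightarrow> (nat \<Rightarrow> nat) \<times> (nat \<Rightarrow> nat) \<Rightarrow> complex" where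
  "charfun d n \<rho> x = tr (\<rho> * weyl d n (vneg d (fst x)) (vneg d (snd x)))"

definition mean_state :: "nat \<Rightarrow> nat \<Rightarrow> complex mat \<Rightarrow> complex mat" where
  "mean_state d n \<rho> = (THE \<sigma>. \<sigma> \<in> carrier_mat (d ^ n) (d ^ n) \<and>
     (\<forall>x \<in> Vn d n. charfun d n \<sigma> x =
        (if cmod (charfun d n \<rho> x) = 1 then charfun d n \<rho> x else 0)))"

text \<open>An abelian group of Weyl operators up to phases: a subgroup S of V^n
  whose Weyl operators pairwise commute.\<close>
definition abelian_weyl_group :: "nat \<Rightarrow> nat \<Rightarrow> ((nat \<Rightarrow> nat) \<times> (nat \<Rightarrow> nat)) set \<Rightarrow> bool" where
  "abelian_weyl_group d n S \<longleftrightarrow> S \<subseteq> Vn d n \<and> ((\<lambda>_. 0), (\<lambda>_. 0)) \<in> S \<and>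
     (\<forall>x \<in> S. \<forall>y \<in> S. vadd d x y \<in> S \<and> Weyl d n x * Weyl d n y = Weyl d n y * Weyl d n x)"

definition cstar_gen :: "nat \<Rightarrow> complex mat set \<Rightarrow> complex mat set" where
  "cstar_gen N T = \<Inter>{A. A \<subseteq> carrier_mat N N \<and> T \<subseteq> A \<and>
      (\<forall>X \<in> A. \<forall>Y \<in> A. X + Y \<in> A \<and> X * Y \<in> A) \<and>
      (\<forall>c. \<forall>X \<in> A. c \<cdot>\<^sub>m X \<in> A) \<and>
      (\<forall>X \<in> A. mat_adjoint X \<in> A)}"

definition projection :: "complex mat \<Rightarrow> bool" where
  "projection P \<longleftrightarrow> mat_adjoint P = P \<and> P * P = P"

definition minimal_projection :: "nat \<Rightarrow> complex mat set \<Rightarrow> complex mat \<Rightarrow> bool" where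
  "minimal_projection N A P \<longleftrightarrow> P \<in> A \<and> projection P \<and> P \<noteq> 0\<^sub>m N N \<and>
     (\<forall>Q \<in> A. projection Q \<and> Q * P = Q \<longrightarrow> Q = 0\<^sub>m N N \<or> Q = P)"

definition mat_rank :: "nat \<Rightarrow> complex mat \<Rightarrow> nat" where
  "mat_rank N A = vec_space.rank N A"

definition MSPS :: "nat \<Rightarrow> nat \<Rightarrow> complex mat \<Rightarrow> bool" where
  "MSPS d n \<sigma> \<longleftrightarrow> (\<exists>S P. abelian_weyl_group d n S \<and>
      minimal_projection (d ^ n) (cstar_gen (d ^ n) (Weyl d n ` S)) P \<and>
      \<sigma> = (1 / of_nat (mat_rank (d ^ n) P)) \<cdot>\<^sub>m P)"

definition mat_fun :: "(real \<Rightarrow> real) \<Rightarrow> complex mat \<Rightarrow> complex mat" where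
  "mat_fun f A = (SOME B. \<exists>U lam. U \<in> carrier_mat (dim_row A) (dim_row A) \<and>
      U * mat_adjoint U = 1\<^sub>m (dim_row A) \<and> mat_adjoint U * U = 1\<^sub>m (dim_row A) \<and>
      A = U * mat_diag (dim_row A) (\<lambda>i. complex_of_real (lam i)) * mat_adjoint U \<and>
      B = U * mat_diag (dim_row A) (\<lambda>i. complex_of_real (f (lam i))) * mat_adjoint U)"

text \<open>Powers on the support (0 powr t = 0), and the logarithm on the support.\<close>
definition mpow :: "complex mat \<Rightarrow> real \<Rightarrow> complex mat" where
  "mpow A t = mat_fun (\<lambda>x. x powr t) A"

definition mlog :: "complex mat \<Rightarrow> complex mat" where
  "mlog A = mat_fun (\<lambda>x. if x > 0 then ln x else 0) A"

definition lmax :: "complex mat \<Rightarrow> real" where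
  "lmax A = Max {Re k | k. eigenvalue A k}"

definition supp_le :: "complex mat \<Rightarrow> complex mat \<Rightarrow> bool" where
  "supp_le \<rho> \<sigma> \<longleftrightarrow> (\<forall>v \<in> carrier_vec (dim_col \<rho>). \<exists>w \<in> carrier_vec (dim_col \<sigma>). \<rho> *\<^sub>v v = \<sigma> *\<^sub>v w)"

text \<open>Sandwiched Renyi relative entropy, with the limits at alpha = 1 (Umegaki) and
  alpha = infinity (max-relative entropy), and +infinity if supp rho is not in supp sigma.\<close>
definition D_renyi :: "ereal \<Rightarrow> complex mat \<Rightarrow> complex mat \<Rightarrow> ereal" where
  "D_renyi \<alpha> \<rho> \<sigma> =
    (if \<not> supp_le \<rho> \<sigma> then \<infinity>
     else if \<alpha> = 1 then ereal (Re (tr (\<rho> * (mlog \<rho> - mlog \<sigma>))))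
     else if \<alpha> = \<infinity> then ereal (ln (lmax (mpow \<sigma> (-1/2) * \<rho> * mpow \<sigma> (-1/2))))
     else (let a = real_of_ereal \<alpha>; s = (1 - a) / (2 * a) in
           ereal (1 / (a - 1) * ln (Re (tr (mpow (mpow \<sigma> s * \<rho> * mpow \<sigma> s) a))))))"

text \<open>Renyi entropy, with limits at alpha = 1 (von Neumann) and alpha = infinity (min-entropy).\<close>
definition H_renyi :: "ereal \<Rightarrow> complex mat \<Rightarrow> real" where
  "H_renyi \<alpha> \<rho> =
    (if \<alpha> = 1 then - Re (tr (\<rho> * mlog \<rho>))
     else if \<alpha> = \<infinity> then - ln (lmax \<rho>)
     else (let a = real_of_ereal \<alpha> in 1 / (1 - a) * ln (Re (tr (mpow \<rho> a)))))"

end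

theory Submission
  imports Defs "Jordan_Normal_Form.Spectral_Radius"
begin

text \<open>
  A minimal stabilizer-projection state is \<open>P / r\<close> with \<open>P\<close> a projection of rank \<open>r\<close>. On such a
  state the sandwiched entropy collapses: \<open>D\<^sub>\<alpha>(\<rho> \<parallel> P / r) = ln r - H\<^sub>\<alpha>(\<rho>)\<close> if \<open>P \<rho> = \<rho>\<close>, and it is
  infinite otherwise. So the claim is that, among the \<open>P\<close> with \<open>P \<rho> = \<rho>\<close>, the mean state gives the
  unique one of least rank.

  A minimal projection \<open>P\<close> of the algebra of an abelian group \<open>S\<close> satisfies \<open>W x P = l x P\<close> for
  phases \<open>l x\<close>, hence equals the average of \<open>cnj (l x) W x\<close> over \<open>S\<close> and has rank \<open>d ^ n / card S\<close>.
  If \<open>P \<rho> = \<rho>\<close> then \<open>W x \<rho> = l x \<rho>\<close>, so \<open>S\<close> lies in the set of all \<open>x\<close> with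
  \<open>cmod (tr (\<rho> W x)) = 1\<close>, and \<open>l\<close> is determined by \<open>\<rho>\<close>. By the equality case of Cauchy-Schwarz that
  set consists exactly of the \<open>x\<close> for which \<open>\<rho>\<close> is an eigenmatrix of \<open>W x\<close>; it is therefore itself an
  abelian group, and its minimal projection that fixes \<open>\<rho>\<close> has the characteristic function of the mean state.
\<close>

text \<open>\<open>mat_fun\<close> is a choice among all diagonalizations, so no power or logarithm
  can be evaluated until a diagonalization is known to exist and the result is known not to depend
  on it. After that the collapse rests on one fact: powers and the logarithm are set to 0 at 0, so a
  function of \<open>t P\<close> is a multiple of \<open>P\<close>, and
  \<open>P \<rho> = \<rho>\<close> absorbs \<open>P\<close> into the state.

  The rank \<open>d ^ n / card S\<close> comes from traces: among the Weyl operators in the average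
  only the identity has nonzero trace. Hence a larger group gives a smaller rank, and competing
  groups need only be compared by inclusion. That the average is a projection at all requires
  \<open>l\<close> to carry the same product phases as the Weyl operators. This is certified by one
  nonzero matrix with eigenvalues \<open>l\<close>: the minimal projection in one use, \<rho> in the
  other. Product phases are carried only as existential numbers of modulus 1, so d = 2 and odd d are
  treated alike.\<close>

section \<open>Adjoints and traces of complex matrices\<close>

lemma dim_mat_adjoint[simp]:
  "dim_row (mat_adjoint A) = dim_col A" "dim_col (mat_adjoint A) = dim_row A"
  by (auto simp: mat_adjoint_def)

lemma mat_adjoint_carrier[simp]: "A \<in> carrier_mat n m \<Longrightarrow> mat_adjoint A \<in> carrier_mat m n"
  by (intro carrier_matI) auto

lemma mat_adjoint_index[simp]:
  "i < dim_col A \<Longrightarrow> j < dim_row A \<Longrightarrow> mat_adjoint A $$ (i, j) = cnj (A $$ (j, i))"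
  by (simp add: mat_adjoint_def mat_of_rows_index)

lemma mat_adjoint_adjoint[simp]: "mat_adjoint (mat_adjoint (A :: complex mat)) = A"
  by (rule eq_matI) auto

lemma mult_mat_index:
  assumes "i < dim_row A" "j < dim_col B" "dim_col A = dim_row B"
  shows "(A * B) $$ (i, j) = (\<Sum>k<dim_row B. A $$ (i, k) * B $$ (k, j))"
  using assms by (auto simp: scalar_prod_def atLeast0LessThan)

lemma mat_adjoint_mult:
  fixes A B :: "complex mat"
  assumes "A \<in> carrier_mat n m" "B \<in> carrier_mat m k"
  shows "mat_adjoint (A * B) = mat_adjoint B * mat_adjoint A"
  using assms by (intro eq_matI) (auto simp: mult_mat_index mult.commute simp del: index_mult_mat(1))

lemma mat_adjoint_one[simp]: "mat_adjoint (1\<^sub>m n :: complex mat) = 1\<^sub>m n"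
  by (rule eq_matI) auto

lemma mat_adjoint_smult[simp]: "mat_adjoint (c \<cdot>\<^sub>m A) = cnj c \<cdot>\<^sub>m mat_adjoint A"
  by (rule eq_matI) auto

lemma mat_adjoint_minus:
  fixes A B :: "complex mat"
  assumes "A \<in> carrier_mat n m" "B \<in> carrier_mat n m"
  shows "mat_adjoint (A - B) = mat_adjoint A - mat_adjoint B"
  using assms by (intro eq_matI) auto

lemma smult_smult_mat: "a \<cdot>\<^sub>m (b \<cdot>\<^sub>m A) = (a * b) \<cdot>\<^sub>m (A :: complex mat)"
  by (rule eq_matI) auto

lemma tr_mult:
  assumes "A \<in> carrier_mat n m" "B \<in> carrier_mat m n"
  shows "tr (A * B) = (\<Sum>i<n. \<Sum>k<m. A $$ (i, k) * B $$ (k, i))"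
  using assms by (auto simp: tr_def mult_mat_index simp del: index_mult_mat(1) intro!: sum.cong)

lemma tr_mult_commute:
  assumes "A \<in> carrier_mat n m" "B \<in> carrier_mat m n"
  shows "tr (A * B) = tr (B * A)"
  by (simp add: tr_mult[OF assms] tr_mult[OF assms(2,1)] mult.commute) (rule sum.swap)

lemma tr_smult[simp]: "A \<in> carrier_mat n n \<Longrightarrow> tr (c \<cdot>\<^sub>m A) = c * tr A"
  by (auto simp: tr_def sum_distrib_left)

lemma tr_one[simp]: "tr (1\<^sub>m n) = of_nat n"
  by (simp add: tr_def)

lemma tr_minus:
  assumes "A \<in> carrier_mat n n" "B \<in> carrier_mat n n"
  shows "tr (A - B) = tr A - tr B"
  using assms by (auto simp: tr_def sum_subtractf)

lemma tr_mat_adjoint: "A \<in> carrier_mat n n \<Longrightarrow> tr (mat_adjoint A) = cnj (tr A)"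
  by (auto simp: tr_def)

text \<open>The trace is the squared Hilbert-Schmidt norm, a sum of squared moduli of entries. Later
  it turns a trace computation into a matrix equation.\<close>

lemma tr_self_adjoint_eq_0:
  assumes B: "B \<in> carrier_mat n m" and "tr (B * mat_adjoint B) = 0"
  shows "B = 0\<^sub>m n m"
proof -
  have "(\<Sum>i<n. \<Sum>k<m. B $$ (i, k) * mat_adjoint B $$ (k, i))
      = (\<Sum>i<n. \<Sum>k<m. of_real ((cmod (B $$ (i, k)))\<^sup>2))"
    using B by (intro sum.cong refl) (simp add: complex_norm_square[symmetric])
  then have "complex_of_real (\<Sum>i<n. \<Sum>k<m. (cmod (B $$ (i, k)))\<^sup>2) = 0"
    using assms tr_mult[OF B mat_adjoint_carrier[OF B]] by simp
  then have "(\<Sum>i<n. \<Sum>k<m. (cmod (B $$ (i, k)))\<^sup>2) = 0"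
    using of_real_eq_0_iff by blast
  then have "\<forall>i<n. \<forall>k<m. B $$ (i, k) = 0"
    by (subst (asm) sum_nonneg_eq_0_iff) (auto simp: sum_nonneg sum_nonneg_eq_0_iff)
  then show ?thesis using B by (intro eq_matI) auto
qed

section \<open>Spectral theorem\<close>

text \<open>The reflection along \<open>w = c v - e_0\<close> exchanges the unit vectors
  \<open>e_0\<close> and \<open>c v\<close>. The phase \<open>c\<close> makes the first entry of
  \<open>c v\<close> real, which a complex reflection needs to carry one vector to the other. The
  result is a self-adjoint unitary whose first column is a multiple of \<open>v\<close>.\<close>

lemma householder:
  fixes v :: "complex vec"
  assumes v: "v \<in> carrier_vec (Suc n)" and norm: "(\<Sum>i<Suc n. (cmod (v $ i))\<^sup>2) = 1"
  shows "\<exists>H c. H \<in> carrier_mat (Suc n) (Suc n) \<and> mat_adjoint H = H \<and> H * H = 1\<^sub>m (Suc n)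
    \<and> cmod c = 1 \<and> (\<forall>i<Suc n. H $$ (i, 0) = c * v $ i)"
proof -
  define c where "c = (if v $ 0 = 0 then 1 else cnj (v $ 0) / of_real (cmod (v $ 0)))"
  define t where "t = cmod (v $ 0)"
  define u where "u i = c * v $ i" for i
  define w where "w i = u i - (if i = 0 then 1 else 0)" for i
  define s where "s = (\<Sum>i<Suc n. w i * cnj (w i))"
  define H where "H = mat (Suc n) (Suc n) (\<lambda>(i, j). (if i = j then 1 else 0) - 2 * w i * cnj (w j) / s)"
  have c: "cmod c = 1" by (auto simp: c_def norm_divide)
  have u0: "u 0 = of_real t"
    using complex_norm_square[of "v $ 0"]
    by (auto simp: u_def c_def t_def power2_eq_square field_simps)
  have "(\<Sum>i<Suc n. (cmod (u i))\<^sup>2) = 1" using norm c by (simp add: u_def norm_mult)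
  then have un: "(\<Sum>i<Suc n. u i * cnj (u i)) = 1"
    by (simp only: complex_norm_square[symmetric] flip: of_real_sum) simp
  have tail: "(\<Sum>i<n. w (Suc i) * cnj (w (Suc i))) = 1 - of_real t * of_real t"
    using un u0 by (simp add: w_def sum.lessThan_Suc_shift algebra_simps del: sum.lessThan_Suc)
  \<comment> \<open>The squared length of the difference of two unit vectors whose inner product is
    the real number \<open>t\<close>.\<close>
  have s: "s = 2 - 2 * of_real t"
    unfolding s_def sum.lessThan_Suc_shift tail by (simp add: w_def u0 algebra_simps)
  \<comment> \<open>Degenerate case \<open>c v = e_0\<close>: division by zero gives 0, so
    \<open>H\<close> is the identity, which is still correct because \<open>w\<close>
    vanishes.\<close>
  have w_s0: "w i = 0" if "s = 0" "i < Suc n" for i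
  proof -
    have "s = complex_of_real (\<Sum>i<Suc n. (cmod (w i))\<^sup>2)"
      by (simp only: s_def complex_norm_square[symmetric] of_real_sum)
    then have "(\<Sum>i<Suc n. (cmod (w i))\<^sup>2) = 0" using that by (metis of_real_eq_0_iff)
    then show ?thesis using that(2) by (subst (asm) sum_nonneg_eq_0_iff) auto
  qed
  have cs: "cnj s = s" by (simp add: s)
  have "H $$ (i, 0) = c * v $ i" if "i < Suc n" for i
  proof (cases "s = 0")
    case True
    then show ?thesis using that w_s0[OF True that] by (auto simp: H_def w_def u_def)
  next
    case False
    have "cnj (w 0) = - s / 2" by (simp add: w_def u0 s)
    then have "H $$ (i, 0) = (if i = 0 then 1 else 0) + w i"
      using that False by (simp add: H_def)
    then show ?thesis by (simp add: w_def u_def)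
  qed
  moreover have "mat_adjoint H = H"
    by (rule eq_matI) (auto simp: H_def cs)
  moreover have "H * H = 1\<^sub>m (Suc n)"
  proof (rule eq_matI)
    fix i j assume "i < dim_row (1\<^sub>m (Suc n))" "j < dim_col (1\<^sub>m (Suc n))"
    then have ij: "i < Suc n" "j < Suc n" by auto
    have "(H * H) $$ (i, j) = (\<Sum>k<Suc n. H $$ (i, k) * H $$ (k, j))"
      using ij by (subst mult_mat_index) (auto simp: H_def)
    also have "\<dots> = (\<Sum>k<Suc n. (if k = i then (if i = j then 1 else 0) - 2 * w i * cnj (w j) / s else 0)
        - (if k = j then 2 * w i * cnj (w j) / s else 0)
        + 4 * w i * cnj (w j) / (s * s) * (w k * cnj (w k)))"
      using ij by (intro sum.cong refl) (auto simp: H_def algebra_simps)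
    also have "\<dots> = (if i = j then 1 else 0) - 4 * w i * cnj (w j) / s
        + 4 * w i * cnj (w j) / (s * s) * s"
      using ij by (simp only: sum.distrib sum_subtractf sum_distrib_left[symmetric] s_def[symmetric])
        (simp add: algebra_simps del: sum.lessThan_Suc)
    also have "\<dots> = (if i = j then 1 else 0)" by (cases "s = 0") auto
    finally show "(H * H) $$ (i, j) = 1\<^sub>m (Suc n) $$ (i, j)" using ij by simp
  qed (auto simp: H_def)
  moreover have "H \<in> carrier_mat (Suc n) (Suc n)" by (simp add: H_def)
  ultimately show ?thesis using c by blast
qed

lemma unit_eigenvector_exists:
  fixes A :: "complex mat"
  assumes A: "A \<in> carrier_mat n n" and n: "n > 0"
  shows "\<exists>v e. v \<in> carrier_vec n \<and> A *\<^sub>v v = e \<cdot>\<^sub>v v \<and> (\<Sum>i<n. (cmod (v $ i))\<^sup>2) = 1"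
proof -
  obtain e where "eigenvalue A e"
    using spectrum_non_empty[OF A n] by (auto simp: spectrum_def)
  then obtain v where v: "v \<in> carrier_vec n" "v \<noteq> 0\<^sub>v n" "A *\<^sub>v v = e \<cdot>\<^sub>v v"
    using A by (auto simp: eigenvalue_def eigenvector_def)
  define s where "s = (\<Sum>i<n. (cmod (v $ i))\<^sup>2)"
  have "s \<noteq> 0"
  proof
    assume "s = 0"
    then have "\<forall>i<n. v $ i = 0" unfolding s_def by (subst (asm) sum_nonneg_eq_0_iff) auto
    then show False using v by (metis eq_vecI carrier_vecD index_zero_vec)
  qed
  then have s: "s > 0" unfolding s_def by (simp add: order.strict_iff_order sum_nonneg)
  define u where "u = of_real (1 / sqrt s) \<cdot>\<^sub>v v"
  have "(\<Sum>i<n. (cmod (u $ i))\<^sup>2) = (\<Sum>i<n. (1 / s) * (cmod (v $ i))\<^sup>2)"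
    using v s by (intro sum.cong refl) (auto simp: u_def norm_mult norm_divide power_mult_distrib power_divide)
  also have "\<dots> = 1" using s by (simp only: sum_distrib_left[symmetric] s_def[symmetric]) simp
  finally have "(\<Sum>i<n. (cmod (u $ i))\<^sup>2) = 1" .
  moreover have "A *\<^sub>v u = e \<cdot>\<^sub>v u"
    using v A by (simp add: u_def mult_mat_vec smult_smult_assoc mult.commute)
  moreover have "u \<in> carrier_vec n" using v by (simp add: u_def)
  ultimately show ?thesis by blast
qed

text \<open>Mirrors the condition inside \<open>mat_fun\<close> word for word, so that the choice
  made there is a choice among such pairs.\<close>

definition unitary_diag :: "nat \<Rightarrow> complex mat \<Rightarrow> complex mat \<Rightarrow> (nat \<Rightarrow> real) \<Rightarrow> bool" where
  "unitary_diag n A U lam \<longleftrightarrow> U \<in> carrier_mat n n \<and> U * mat_adjoint U = 1\<^sub>m n \<and>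
     mat_adjoint U * U = 1\<^sub>m n \<and>
     A = U * mat_diag n (\<lambda>i. complex_of_real (lam i)) * mat_adjoint U"

text \<open>Deflation: in a Householder basis starting with a unit eigenvector, the first column
  vanishes below the diagonal. Self-adjointness then clears the first row too, and the induction
  hypothesis diagonalizes the remaining block.\<close>

theorem hermitian_unitary_diag:
  fixes A :: "complex mat"
  assumes "A \<in> carrier_mat n n" "mat_adjoint A = A"
  shows "\<exists>U lam. unitary_diag n A U lam"
  using assms
proof (induction n arbitrary: A)
  case 0
  then show ?case
    by (intro exI[of _ "1\<^sub>m 0"] exI[of _ "\<lambda>_. 0"]) (auto simp: unitary_diag_def)
next
  case (Suc n)
  note A = Suc.prems(1)
  let ?C = "carrier_mat (Suc n) (Suc n)"
  obtain v e where v: "v \<in> carrier_vec (Suc n)" "A *\<^sub>v v = e \<cdot>\<^sub>v v"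
      "(\<Sum>i<Suc n. (cmod (v $ i))\<^sup>2) = 1"
    using unit_eigenvector_exists[OF A] by auto
  obtain H c where H: "H \<in> ?C" "mat_adjoint H = H" "H * H = 1\<^sub>m (Suc n)" "cmod c = 1"
      "\<forall>i<Suc n. H $$ (i, 0) = c * v $ i"
    using householder[OF v(1,3)] by blast
  define A' where "A' = H * (A * H)"
  have A': "A' \<in> ?C" using A H by (auto simp: A'_def)
  have herm: "mat_adjoint A' = A'"
    using A H Suc.prems(2) unfolding A'_def
    by (subst mat_adjoint_mult[of _ "Suc n" "Suc n" _ "Suc n"], auto)
       (subst mat_adjoint_mult[of _ "Suc n" "Suc n" _ "Suc n"],
         auto simp: assoc_mult_mat[of _ "Suc n" "Suc n" _ "Suc n" _ "Suc n"])
  have AH: "(A * H) $$ (i, 0) = e * H $$ (i, 0)" if i: "i < Suc n" for i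
  proof -
    have "(A * H) $$ (i, 0) = (\<Sum>k<Suc n. A $$ (i, k) * H $$ (k, 0))"
      using i A H by (subst mult_mat_index) auto
    also have "\<dots> = c * (\<Sum>k<Suc n. A $$ (i, k) * v $ k)"
      using H(5) by (auto simp: sum_distrib_left mult_ac simp del: sum.lessThan_Suc intro!: sum.cong)
    also have "(\<Sum>k<Suc n. A $$ (i, k) * v $ k) = (A *\<^sub>v v) $ i"
      using i A v(1) by (auto simp: scalar_prod_def atLeast0LessThan intro!: sum.cong simp del: sum.lessThan_Suc sum.op_ivl_Suc)
    also have "\<dots> = e * v $ i" using v(1,2) i by simp
    finally show ?thesis using H(5) i by simp
  qed
  have col0: "A' $$ (i, 0) = (if i = 0 then e else 0)" if i: "i < Suc n" for i
  proof -
    have "A' $$ (i, 0) = (\<Sum>k<Suc n. H $$ (i, k) * (A * H) $$ (k, 0))"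
      unfolding A'_def using i A H by (subst mult_mat_index) auto
    also have "\<dots> = e * (\<Sum>k<Suc n. H $$ (i, k) * H $$ (k, 0))"
      using AH by (auto simp: sum_distrib_left mult_ac simp del: sum.lessThan_Suc intro!: sum.cong)
    also have "(\<Sum>k<Suc n. H $$ (i, k) * H $$ (k, 0)) = (H * H) $$ (i, 0)"
      using i H(1) by (subst mult_mat_index) auto
    finally show ?thesis using i by (simp add: H(3))
  qed
  have sym: "A' $$ (i, j) = cnj (A' $$ (j, i))" if "i < Suc n" "j < Suc n" for i j
    using that A' arg_cong[OF herm, of "\<lambda>M. M $$ (i, j)"] by simp
  have row0: "A' $$ (0, j) = (if j = 0 then e else 0)" if j: "j < Suc n" for j
    using sym[of 0 j] col0[OF j] j sym[of 0 0] col0[of 0] by auto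
  \<comment> \<open>Diagonal entries of a self-adjoint matrix are real; the diagonalization must
    have real eigenvalues.\<close>
  have e: "e = of_real (Re e)" using sym[of 0 0] col0[of 0] by (simp add: complex_eq_iff)
  define B where "B = mat n n (\<lambda>(i, j). A' $$ (Suc i, Suc j))"
  have "mat_adjoint B = B"
    by (rule eq_matI) (auto simp: B_def sym[symmetric])
  then obtain U lam where U: "unitary_diag n B U lam"
    using Suc.IH[of B] by (auto simp: B_def)
  define D where "D = mat_diag n (\<lambda>i. complex_of_real (lam i))"
  have Uc: "U \<in> carrier_mat n n" "U * mat_adjoint U = 1\<^sub>m n" "mat_adjoint U * U = 1\<^sub>m n"
      "B = U * D * mat_adjoint U" and Dc: "D \<in> carrier_mat n n"
    using U by (auto simp: unitary_diag_def D_def)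
  \<comment> \<open>Bordering by a scalar respects products, adjoints and the identity, so a unitary
    diagonalization of \<open>B\<close> borders to one of \<open>A'\<close>.\<close>
  define ext where "ext a M = four_block_mat (mat 1 1 (\<lambda>_. a)) (0\<^sub>m 1 n) (0\<^sub>m n 1) M"
    for a :: complex and M
  have ext_mult: "ext a M * ext b K = ext (a * b) (M * K)"
    if "M \<in> carrier_mat n n" "K \<in> carrier_mat n n" for a b M K
    unfolding ext_def using that
    by (subst mult_four_block_mat[of _ 1 1 _ n _ n _ _ 1 _ n])
       (auto intro!: cong_four_block_mat simp: scalar_prod_def)
  have ext_adj: "mat_adjoint (ext a M) = ext (cnj a) (mat_adjoint M)"
    if "M \<in> carrier_mat n n" for a M
    using that by (intro eq_matI) (auto simp: ext_def)
  have ext_c: "ext a M \<in> ?C" if "M \<in> carrier_mat n n" for a M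
    using that by (auto simp: ext_def)
  have ext_one: "ext 1 (1\<^sub>m n) = 1\<^sub>m (Suc n)"
    by (rule eq_matI) (auto simp: ext_def)
  have A'_ext: "A' = ext e B"
  proof (rule eq_matI)
    fix i j assume "i < dim_row (ext e B)" "j < dim_col (ext e B)"
    then have "i < Suc n" "j < Suc n" by (auto simp: ext_def B_def)
    then show "A' $$ (i, j) = ext e B $$ (i, j)"
      using col0[of i] row0[of j] by (cases i; cases j) (auto simp: ext_def B_def)
  qed (use A' in \<open>auto simp: ext_def B_def\<close>)
  define lam' where "lam' i = (case i of 0 \<Rightarrow> Re e | Suc k \<Rightarrow> lam k)" for i
  have D': "mat_diag (Suc n) (\<lambda>i. complex_of_real (lam' i)) = ext e D"
    by (rule eq_matI) (use e in \<open>auto simp: ext_def D_def mat_diag_def lam'_def split: nat.split\<close>)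
  define X where "X = ext 1 U"
  have X: "X \<in> ?C" "X * mat_adjoint X = 1\<^sub>m (Suc n)" "mat_adjoint X * X = 1\<^sub>m (Suc n)"
      "A' = X * ext e D * mat_adjoint X"
    using Uc Dc by (auto simp: X_def ext_adj ext_mult ext_one ext_c A'_ext)
  have XD: "ext e D \<in> ?C" using Dc ext_c by simp
  note assoc = assoc_mult_mat[of _ "Suc n" "Suc n" _ "Suc n" _ "Suc n"]
  have cancel: "H * (H * K) = K" if "K \<in> ?C" for K
    using that H(1,3) by (simp add: assoc[symmetric])
  have cancel': "X * (mat_adjoint X * K) = K" "mat_adjoint X * (X * K) = K" if "K \<in> ?C" for K
    using that X by (simp_all add: assoc[symmetric])
  have adj: "mat_adjoint (H * X) = mat_adjoint X * H"
    using H X by (subst mat_adjoint_mult[of _ "Suc n" "Suc n" _ "Suc n"]) auto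
  have "H * A' * H = A"
    using A H by (simp add: A'_def assoc cancel)
  then have "A = H * X * ext e D * (mat_adjoint X * H)"
    using H X(1) XD unfolding X(4) by (simp add: assoc mult_carrier_mat[of _ "Suc n" "Suc n" _ "Suc n"])
  moreover have "H * X * (mat_adjoint X * H) = 1\<^sub>m (Suc n)" "mat_adjoint X * H * (H * X) = 1\<^sub>m (Suc n)"
    using H X by (simp_all add: assoc mult_carrier_mat[of _ "Suc n" "Suc n" _ "Suc n"] cancel cancel')
  ultimately have "unitary_diag (Suc n) A (H * X) lam'"
    using H X by (simp add: unitary_diag_def D' adj mult_carrier_mat[of _ "Suc n" "Suc n" _ "Suc n"])
  then show ?case by blast
qed

section \<open>Functional calculus of self-adjoint matrices\<close>

definition diag_conj :: "nat \<Rightarrow> complex mat \<Rightarrow> (nat \<Rightarrow> real) \<Rightarrow> complex mat" where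
  "diag_conj n U g = U * mat_diag n (\<lambda>i. complex_of_real (g i)) * mat_adjoint U"

lemma diag_conj_carrier[simp]: "U \<in> carrier_mat n n \<Longrightarrow> diag_conj n U g \<in> carrier_mat n n"
  by (simp add: diag_conj_def mult_carrier_mat[of _ n n _ n])

lemma dim_mat_diag[simp]: "dim_row (mat_diag n f) = n" "dim_col (mat_diag n f) = n"
  by (simp_all add: mat_diag_def)

lemma unitary_diagD:
  assumes "unitary_diag n A U lam"
  shows "U \<in> carrier_mat n n" "U * mat_adjoint U = 1\<^sub>m n" "mat_adjoint U * U = 1\<^sub>m n"
    "A = diag_conj n U lam" "A \<in> carrier_mat n n"
  using assms by (auto simp: unitary_diag_def diag_conj_def mult_carrier_mat[of _ n n _ n])

lemma diag_conj_index:
  assumes "U \<in> carrier_mat n n" "i < n" "j < n"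
  shows "diag_conj n U g $$ (i, j) = (\<Sum>k<n. U $$ (i, k) * of_real (g k) * cnj (U $$ (j, k)))"
proof -
  have "diag_conj n U g $$ (i, j)
      = (\<Sum>k<n. (U * mat_diag n (\<lambda>i. complex_of_real (g i))) $$ (i, k) * mat_adjoint U $$ (k, j))"
    unfolding diag_conj_def using assms by (subst mult_mat_index) auto
  also have "\<dots> = (\<Sum>k<n. U $$ (i, k) * of_real (g k) * cnj (U $$ (j, k)))"
    using assms by (intro sum.cong refl) (auto simp: mat_diag_mult_right[of _ n])
  finally show ?thesis .
qed

lemma diag_conj_scale:
  assumes "U \<in> carrier_mat n n" "\<And>i. i < n \<Longrightarrow> g i = c * h i"
  shows "diag_conj n U g = of_real c \<cdot>\<^sub>m diag_conj n U h"
  using assms carrier_matD[OF diag_conj_carrier[OF assms(1)]]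
  by (intro eq_matI) (auto simp: diag_conj_index sum_distrib_left mult_ac intro!: sum.cong)

lemma tr_diag_conj:
  assumes "unitary_diag n A U lam"
  shows "tr (diag_conj n U g) = of_real (\<Sum>i<n. g i)"
proof -
  let ?D = "mat_diag n (\<lambda>i. complex_of_real (g i))"
  note U = unitary_diagD[OF assms]
  have "tr (diag_conj n U g) = tr (mat_adjoint U * (U * ?D))"
    unfolding diag_conj_def using U by (intro tr_mult_commute[of _ n n]) (auto simp: mult_carrier_mat[of _ n n _ n])
  also have "mat_adjoint U * (U * ?D) = ?D"
    using U by (simp add: assoc_mult_mat[of _ n n _ n _ n, symmetric] left_mult_one_mat[of _ n n])
  finally show ?thesis by (simp add: tr_def mat_diag_def)
qed

lemma unitary_diag_smult:
  assumes "unitary_diag n A U lam"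
  shows "unitary_diag n (of_real t \<cdot>\<^sub>m A) U (\<lambda>i. t * lam i)"
  using unitary_diagD[OF assms] diag_conj_scale[of U n "\<lambda>i. t * lam i" t lam]
  by (simp add: unitary_diag_def diag_conj_def)

text \<open>The spectral calculus does not depend on the diagonalization: the change of basis
  \<open>V\<close> between two diagonalizations only connects equal eigenvalues.\<close>
lemma diag_conj_unique:
  assumes "unitary_diag n A U lam" "unitary_diag n A U' lam'"
  shows "diag_conj n U (\<lambda>i. f (lam i)) = diag_conj n U' (\<lambda>i. f (lam' i))"
proof -
  note U = unitary_diagD[OF assms(1)] and U' = unitary_diagD[OF assms(2)]
  note assoc = assoc_mult_mat[of _ n n _ n _ n] and mc = mult_carrier_mat[of _ n n _ n] left_mult_one_mat[of _ n n] right_mult_one_mat[of _ n n]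
  define D where "D g = mat_diag n (\<lambda>i. complex_of_real (g i))" for g
  have D[simp]: "D g \<in> carrier_mat n n" for g by (simp add: D_def)
  define V where "V = mat_adjoint U' * U"
  have V: "V \<in> carrier_mat n n" using U U' by (simp add: V_def mc)
  have e: "U * D lam * mat_adjoint U = U' * D lam' * mat_adjoint U'"
    using U(4) U'(4) by (simp add: diag_conj_def D_def)
  have c: "mat_adjoint U * (U * K) = K" "mat_adjoint U' * (U' * K) = K" "U' * (mat_adjoint U' * K) = K"
    if "K \<in> carrier_mat n n" for K
    using that U U' by (simp_all add: assoc[symmetric])
  have "V * D lam = mat_adjoint U' * (U * D lam * mat_adjoint U) * U"
    using U U' by (simp add: V_def assoc mc)
  also have "\<dots> = D lam' * V"
    unfolding e using U U' by (simp add: V_def assoc mc c)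
  finally have VD: "V * D lam = D lam' * V" .
  have "V $$ (i, j) * of_real (lam j) = of_real (lam' i) * V $$ (i, j)" if "i < n" "j < n" for i j
    using that V arg_cong[OF VD, of "\<lambda>M. M $$ (i, j)"]
    by (simp add: D_def mat_diag_mult_left[OF V] mat_diag_mult_right[OF V])
  then have "V $$ (i, j) = 0 \<or> lam j = lam' i" if "i < n" "j < n" for i j
    using that by (metis mult.commute mult_cancel_left of_real_eq_iff)
  then have "V * D (\<lambda>i. f (lam i)) = D (\<lambda>i. f (lam' i)) * V"
    unfolding D_def mat_diag_mult_left[OF V] mat_diag_mult_right[OF V] by (intro eq_matI) fastforce+
  then have "U' * (V * D (\<lambda>i. f (lam i))) * mat_adjoint U = U' * (D (\<lambda>i. f (lam' i)) * V) * mat_adjoint U"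
    by simp
  then show ?thesis
    using U U' by (simp add: V_def assoc mc c diag_conj_def D_def[symmetric])
qed

text \<open>The choice in \<open>mat_fun\<close> picks some diagonalization; by
  \<open>diag_conj_unique\<close> any other one gives the same matrix, so every computation may use
  a convenient basis.\<close>

lemma mat_fun_eq_diag_conj:
  assumes "unitary_diag n A U lam"
  shows "mat_fun f A = diag_conj n U (\<lambda>i. f (lam i))"
proof -
  have n: "dim_row A = n" using unitary_diagD(5)[OF assms] by simp
  have "\<exists>U lam. unitary_diag n A U lam \<and> mat_fun f A = diag_conj n U (\<lambda>i. f (lam i))"
    unfolding mat_fun_def n unitary_diag_def diag_conj_def conj_assoc
    by (rule someI_ex) (use assms in \<open>auto simp: unitary_diag_def\<close>)
  then show ?thesis using diag_conj_unique[OF _ assms] by auto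
qed

text \<open>The characteristic polynomial is invariant under similarity and splits over the
  diagonal. This makes \<open>lmax\<close> computable from \<open>lam\<close>.\<close>

lemma eigenvalue_iff_diag:
  assumes "unitary_diag n A U lam"
  shows "eigenvalue A k \<longleftrightarrow> (\<exists>i<n. k = of_real (lam i))"
proof -
  note U = unitary_diagD[OF assms]
  let ?D = "mat_diag n (\<lambda>i. complex_of_real (lam i))"
  have "similar_mat A ?D"
    unfolding similar_mat_def similar_mat_wit_def Let_def
    using U assms by (intro exI[of _ U] exI[of _ "mat_adjoint U"]) (auto simp: unitary_diag_def)
  moreover have "upper_triangular ?D" by (auto simp: mat_diag_def)
  ultimately have "char_poly A = (\<Prod>a\<leftarrow>diag_mat ?D. [:- a, 1:])"
    using char_poly_upper_triangular[of ?D n] char_poly_similar[of A ?D] by simp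
  then show ?thesis
    using eigenvalue_root_char_poly[OF U(5)]
    by (auto simp: poly_prod_list prod_list_zero_iff diag_mat_def mat_diag_def)
qed

lemma lmax_eq_Max:
  assumes "unitary_diag n A U lam"
  shows "lmax A = Max (lam ` {..<n})"
proof -
  have "{Re k |k. eigenvalue A k} = lam ` {..<n}"
    unfolding eigenvalue_iff_diag[OF assms] by force
  then show ?thesis by (simp add: lmax_def)
qed

section \<open>Positive semidefinite matrices, projections and rank\<close>

text \<open>\<open>lam i\<close> is the quadratic form of \<open>A\<close> evaluated at column
  \<open>i\<close> of \<open>U\<close>.\<close>

lemma psd_unitary_diag_nonneg:
  assumes "psd n A" "unitary_diag n A U lam" "i < n"
  shows "lam i \<ge> 0"
proof -
  note U = unitary_diagD[OF assms(2)]
  let ?D = "mat_diag n (\<lambda>i. complex_of_real (lam i))"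
  have "mat_adjoint U * (U * K) = K" if "K \<in> carrier_mat n n" for K
    using that U by (simp add: left_mult_one_mat[of _ n n] flip: assoc_mult_mat[of _ n n _ n _ n])
  then have "mat_adjoint U * (A * U) = ?D"
    using U(1,3) unfolding U(4) diag_conj_def
    by (simp add: assoc_mult_mat[of _ n n _ n _ n] mult_carrier_mat[of _ n n _ n] right_mult_one_mat[of _ n n])
  then have "of_real (lam i) = (mat_adjoint U * (A * U)) $$ (i, i)"
    using assms(3) by (simp add: mat_diag_def)
  also have "\<dots> = (\<Sum>k<n. mat_adjoint U $$ (i, k) * (A * U) $$ (k, i))"
    using assms(3) U(1,5) by (subst mult_mat_index) auto
  also have "\<dots> = (\<Sum>k<n. cnj (col U i $ k) * (A *\<^sub>v col U i) $ k)"
    using assms(3) U(1,5) by (intro sum.cong refl) auto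
  finally have "lam i = Re (\<Sum>k<n. cnj (col U i $ k) * (A *\<^sub>v col U i) $ k)"
    by (metis Re_complex_of_real)
  moreover have "col U i \<in> carrier_vec n" using U(1) assms(3) by simp
  ultimately show ?thesis using assms(1) unfolding psd_def by metis
qed

lemma psd_carrier: "psd n A \<Longrightarrow> A \<in> carrier_mat n n"
  and psd_adjoint: "psd n A \<Longrightarrow> mat_adjoint A = A"
  by (auto simp: psd_def hermitian_def)

lemma psd_factor:
  assumes "psd n A"
  shows "\<exists>B \<in> carrier_mat n n. A = B * mat_adjoint B"
proof -
  obtain U lam where ud: "unitary_diag n A U lam"
    using hermitian_unitary_diag[OF psd_carrier[OF assms] psd_adjoint[OF assms]] by blast
  note U = unitary_diagD[OF ud]
  define S where "S = mat_diag n (\<lambda>i. complex_of_real (sqrt (lam i)))"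
  have S: "S \<in> carrier_mat n n" "mat_adjoint S = S"
    by (auto simp: S_def mat_diag_def intro!: eq_matI)
  have "S * S = mat_diag n (\<lambda>i. complex_of_real (lam i))"
    using psd_unitary_diag_nonneg[OF assms ud]
    unfolding S_def mat_diag_diag by (auto simp: mat_diag_def simp flip: of_real_mult intro!: eq_matI)
  then have "A = U * (S * S) * mat_adjoint U"
    using U(4) by (simp add: diag_conj_def)
  then have "A = U * S * mat_adjoint (U * S)"
    using U(1) S unfolding mat_adjoint_mult[OF U(1) S(1)]
    by (simp add: assoc_mult_mat[of _ n n _ n _ n] mult_carrier_mat[of _ n n _ n])
  then show ?thesis using mult_carrier_mat[OF U(1) S(1)] by blast
qed

text \<open>The diagonal form inherits idempotence, so each eigenvalue solves
  \<open>x * x = x\<close>.\<close>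

lemma projection_diag:
  assumes "P \<in> carrier_mat n n" "projection P"
  shows "\<exists>U lam. unitary_diag n P U lam \<and> (\<forall>i<n. lam i = 0 \<or> lam i = 1)"
proof -
  obtain U lam where ud: "unitary_diag n P U lam"
    using hermitian_unitary_diag[of P n] assms unfolding projection_def by blast
  note U = unitary_diagD[OF ud]
  let ?D = "mat_diag n (\<lambda>i. complex_of_real (lam i))"
  note assoc = assoc_mult_mat[of _ n n _ n _ n] and mc = mult_carrier_mat[of _ n n _ n] left_mult_one_mat[of _ n n] right_mult_one_mat[of _ n n]
  have c: "mat_adjoint U * (U * K) = K" if "K \<in> carrier_mat n n" for K
    using that U by (simp add: assoc[symmetric])
  have D: "?D = mat_adjoint U * P * U"
    unfolding U(4) diag_conj_def using U by (simp add: assoc mc c)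
  have P: "P * P = P" using assms by (simp add: projection_def)
  have "mat_adjoint U * P * U * (mat_adjoint U * P * U) = mat_adjoint U * (P * (U * mat_adjoint U) * P) * U"
    using U(1) assms(1) by (simp add: assoc mc)
  also have "\<dots> = mat_adjoint U * P * U"
    using U(2) assms(1) P by simp
  finally have "?D * ?D = ?D" unfolding D .
  then have DD: "(?D * ?D) $$ (i, i) = ?D $$ (i, i)" for i by simp
  have "complex_of_real (lam i) * of_real (lam i) = of_real (lam i)" if "i < n" for i
    using DD[of i] that unfolding mat_diag_diag by (simp add: mat_diag_def)
  then show ?thesis using ud by (auto simp flip: of_real_mult)
qed

lemma rank_sum_outer_le:
  fixes u v :: "'i \<Rightarrow> nat \<Rightarrow> complex"
  assumes "finite J"
  shows "vec_space.rank n (mat n n (\<lambda>(a, b). \<Sum>i\<in>J. u i a * v i b)) \<le> card J"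
  using assms
proof (induction J)
  case empty
  have "mat n n (\<lambda>(a, b). \<Sum>i\<in>{}. u i a * v i b) = 0\<^sub>m n n" by (intro eq_matI) auto
  then show ?case using vec_space.rank_0I[of n n] by (metis card.empty le_refl)
next
  case (insert x F)
  have "mat n n (\<lambda>(a, b). \<Sum>i\<in>insert x F. u i a * v i b)
      = mat n n (\<lambda>(a, b). u x a * v x b) + mat n n (\<lambda>(a, b). \<Sum>i\<in>F. u i a * v i b)"
    using insert by (intro eq_matI) auto
  moreover have "vec_space.rank n (mat n n (\<lambda>(a, b). u x a * v x b)) \<le> 1"
    by (rule vec_space.rank_le_1_product_entries[where f = "u x" and g = "v x" and nc = n]) auto
  ultimately show ?case
    using insert vec_space.rank_subadditive[of "mat n n (\<lambda>(a, b). u x a * v x b)" n n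
        "mat n n (\<lambda>(a, b). \<Sum>i\<in>F. u i a * v i b)"] by simp
qed

text \<open>Subadditivity applied to \<open>P + (1 - P) = 1\<close> turns the upper bounds for both ranks into
  equalities.\<close>
lemma rank_projection:
  assumes "P \<in> carrier_mat n n" "projection P"
  shows "of_nat (mat_rank n P) = tr P"
proof -
  obtain U lam where ud: "unitary_diag n P U lam" and lam: "\<forall>i<n. lam i = 0 \<or> lam i = 1"
    using projection_diag[OF assms] by blast
  note U = unitary_diagD[OF ud]
  define I where "I = {i. i < n \<and> lam i = 1}"
  \<comment> \<open>\<open>M J\<close> is the projection onto the span of the columns of
    \<open>U\<close> indexed by \<open>J\<close>; \<open>I\<close> gives \<open>P\<close> and its
    complement gives \<open>1 - P\<close>.\<close>
  define M where "M J = mat n n (\<lambda>(a, b). \<Sum>i\<in>J. U $$ (a, i) * cnj (U $$ (b, i)))" for J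
  have I: "I \<subseteq> {..<n}" by (auto simp: I_def)
  have P: "P = M I"
  proof (rule eq_matI)
    fix a b assume "a < dim_row (M I)" "b < dim_col (M I)"
    then have ab: "a < n" "b < n" by (auto simp: M_def)
    have "P $$ (a, b) = (\<Sum>k<n. U $$ (a, k) * of_real (lam k) * cnj (U $$ (b, k)))"
      unfolding U(4) by (rule diag_conj_index[OF U(1) ab])
    also have "\<dots> = (\<Sum>k\<in>I. U $$ (a, k) * cnj (U $$ (b, k)))"
      using lam by (intro sum.mono_neutral_cong_right) (auto simp: I_def)
    finally show "P $$ (a, b) = M I $$ (a, b)" using ab by (simp add: M_def)
  qed (use assms in \<open>auto simp: M_def\<close>)
  have "M I + M ({..<n} - I) = U * mat_adjoint U"
  proof (rule eq_matI)
    fix a b assume "a < dim_row (U * mat_adjoint U)" "b < dim_col (U * mat_adjoint U)"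
    then have ab: "a < n" "b < n" using U by auto
    have "(U * mat_adjoint U) $$ (a, b) = (\<Sum>k<n. U $$ (a, k) * cnj (U $$ (b, k)))"
      using ab U(1) by (subst mult_mat_index) auto
    also have "\<dots> = (\<Sum>k\<in>{..<n} - I. U $$ (a, k) * cnj (U $$ (b, k))) + (\<Sum>k\<in>I. U $$ (a, k) * cnj (U $$ (b, k)))"
      by (rule sum.subset_diff) (use I in auto)
    finally show "(M I + M ({..<n} - I)) $$ (a, b) = (U * mat_adjoint U) $$ (a, b)"
      using ab by (simp add: M_def)
  qed (use U in \<open>auto simp: M_def\<close>)
  then have "vec_space.rank n (M I + M ({..<n} - I)) = n"
    using U(2) vec_space.det_rank_iff[of "1\<^sub>m n :: complex mat" n] by simp
  moreover have "vec_space.rank n (M I + M ({..<n} - I))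
      \<le> vec_space.rank n (M I) + vec_space.rank n (M ({..<n} - I))"
    by (rule vec_space.rank_subadditive) (auto simp: M_def)
  moreover have "vec_space.rank n (M I) \<le> card I"
    unfolding M_def by (rule rank_sum_outer_le) (auto simp: I_def)
  moreover have "vec_space.rank n (M ({..<n} - I)) \<le> card ({..<n} - I)"
    unfolding M_def by (rule rank_sum_outer_le) auto
  moreover have "card ({..<n} - I) = n - card I" "card I \<le> n"
    using I card_mono[OF _ I] by (auto simp: card_Diff_subset finite_subset)
  ultimately have "mat_rank n P = card I" unfolding mat_rank_def P by linarith
  moreover have "tr P = of_real (\<Sum>i<n. lam i)"
    using tr_diag_conj[OF ud, of lam] U(4) by simp
  moreover have "(\<Sum>i<n. lam i) = (\<Sum>i\<in>I. 1)"
    using lam by (intro sum.mono_neutral_cong_right) (auto simp: I_def)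
  ultimately show ?thesis by simp
qed

section \<open>Entropies relative to a normalized projection\<close>

text \<open>The eigenvalues of \<open>t P\<close> are 0 and \<open>t\<close>. With
  \<open>f 0 = 0\<close> the kernel stays a kernel, even for negative powers and for the logarithm,
  since both are extended by 0 at 0.\<close>

lemma mat_fun_scaled_projection:
  assumes "P \<in> carrier_mat n n" "projection P" "f 0 = 0"
  shows "mat_fun f (of_real t \<cdot>\<^sub>m P) = of_real (f t) \<cdot>\<^sub>m P"
proof -
  obtain U lam where ud: "unitary_diag n P U lam" and lam: "\<forall>i<n. lam i = 0 \<or> lam i = 1"
    using projection_diag[OF assms(1,2)] by blast
  have "mat_fun f (of_real t \<cdot>\<^sub>m P) = diag_conj n U (\<lambda>i. f (t * lam i))"
    by (rule mat_fun_eq_diag_conj[OF unitary_diag_smult[OF ud]])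
  also have "\<dots> = of_real (f t) \<cdot>\<^sub>m diag_conj n U lam"
    using lam assms(3) by (intro diag_conj_scale unitary_diagD[OF ud]) auto
  finally show ?thesis using unitary_diagD(4)[OF ud] by simp
qed

lemma mpow_smult:
  assumes "A \<in> carrier_mat n n" "mat_adjoint A = A"
  shows "mpow (of_real t \<cdot>\<^sub>m A) a = of_real (t powr a) \<cdot>\<^sub>m mpow A a"
proof -
  obtain U lam where ud: "unitary_diag n A U lam" using hermitian_unitary_diag[OF assms] by blast
  show ?thesis
    unfolding mpow_def mat_fun_eq_diag_conj[OF ud] mat_fun_eq_diag_conj[OF unitary_diag_smult[OF ud]]
    by (intro diag_conj_scale unitary_diagD[OF ud]) (auto simp: powr_mult)
qed

lemma mat_fun_carrier:
  assumes "A \<in> carrier_mat n n" "mat_adjoint A = A"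
  shows "mat_fun f A \<in> carrier_mat n n"
  using hermitian_unitary_diag[OF assms] by (auto simp: mat_fun_eq_diag_conj unitary_diagD(1))

lemma lmax_smult:
  assumes "A \<in> carrier_mat n n" "mat_adjoint A = A" "n > 0" "t \<ge> 0"
  shows "lmax (of_real t \<cdot>\<^sub>m A) = t * lmax A"
proof -
  obtain U lam where ud: "unitary_diag n A U lam" using hermitian_unitary_diag[OF assms(1,2)] by blast
  have "mono (\<lambda>x. t * x)" using assms(4) by (auto simp: mono_def mult_left_mono)
  then have "t * Max (lam ` {..<n}) = Max ((\<lambda>x. t * x) ` lam ` {..<n})"
    by (rule mono_Max_commute) (use assms(3) in auto)
  then show ?thesis
    by (simp add: lmax_eq_Max[OF ud] lmax_eq_Max[OF unitary_diag_smult[OF ud]] image_image)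
qed

text \<open>Nonnegative eigenvalues with sum 1 cannot all be 0. The positive one keeps the arguments
  of the logarithms in the entropies positive.\<close>

lemma density_unitary_diag:
  assumes "density n \<rho>"
  shows "\<exists>U lam. unitary_diag n \<rho> U lam \<and> (\<forall>i<n. lam i \<ge> 0) \<and> (\<exists>i<n. lam i > 0)"
proof -
  have psd: "psd n \<rho>" and tr: "tr \<rho> = 1" using assms by (auto simp: density_def)
  obtain U lam where ud: "unitary_diag n \<rho> U lam"
    using hermitian_unitary_diag[OF psd_carrier[OF psd] psd_adjoint[OF psd]] by blast
  have "complex_of_real (\<Sum>i<n. lam i) = 1"
    using tr_diag_conj[OF ud, of lam] unitary_diagD(4)[OF ud] tr by simp
  then have "(\<Sum>i<n. lam i) = 1" using of_real_eq_1_iff by blast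
  then have "\<exists>i<n. lam i > 0"
    using sum_nonpos[of "{..<n}" lam] by (force simp: not_less[symmetric])
  then show ?thesis using ud psd_unitary_diag_nonneg[OF psd ud] by blast
qed

lemma density_tr_mpow_pos:
  assumes "density n \<rho>"
  shows "Re (tr (mpow \<rho> a)) > 0"
proof -
  obtain U lam i where ud: "unitary_diag n \<rho> U lam" "\<forall>i<n. lam i \<ge> 0" "i < n" "lam i > 0"
    using density_unitary_diag[OF assms] by blast
  have "(\<Sum>i<n. lam i powr a) > 0"
    using ud by (intro sum_pos2[of _ i]) auto
  then show ?thesis
    by (simp add: mpow_def mat_fun_eq_diag_conj[OF ud(1)] tr_diag_conj[OF ud(1)])
qed

lemma density_lmax_pos:
  assumes "density n \<rho>"
  shows "lmax \<rho> > 0"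
proof -
  obtain U lam i where ud: "unitary_diag n \<rho> U lam" "i < n" "lam i > 0"
    using density_unitary_diag[OF assms] by blast
  then show ?thesis by (subst lmax_eq_Max[OF ud(1)], subst Max_gr_iff) auto
qed

lemma smult_mat_mult_vec:
  assumes "A \<in> carrier_mat n m" "v \<in> carrier_vec m"
  shows "(c \<cdot>\<^sub>m A) *\<^sub>v v = c \<cdot>\<^sub>v (A *\<^sub>v (v :: complex vec))"
  using assms by (intro eq_vecI) (auto simp: scalar_prod_def sum_distrib_left mult_ac)

text \<open>The range of \<open>t P\<close> is the range of \<open>P\<close>, that is, the vectors
  fixed by \<open>P\<close>. So the inclusion of ranges says that \<open>P\<close> fixes every
  column of \<rho>.\<close>

lemma supp_le_scaled_projection:
  assumes P: "P \<in> carrier_mat n n" "projection P" and \<rho>: "\<rho> \<in> carrier_mat n n" and t: "t \<noteq> 0"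
  shows "supp_le \<rho> (t \<cdot>\<^sub>m P) \<longleftrightarrow> P * \<rho> = \<rho>"
proof
  have PP: "P * P = P" using P by (simp add: projection_def)
  assume s: "supp_le \<rho> (t \<cdot>\<^sub>m P)"
  show "P * \<rho> = \<rho>"
  proof (rule eq_matI)
    fix i j assume ij: "i < dim_row \<rho>" "j < dim_col \<rho>"
    have j: "\<rho> *\<^sub>v unit_vec n j = col \<rho> j" using \<rho> ij by (intro eq_vecI) auto
    obtain w where w: "w \<in> carrier_vec n" "\<rho> *\<^sub>v unit_vec n j = (t \<cdot>\<^sub>m P) *\<^sub>v w"
      using bspec[OF s[unfolded supp_le_def], of "unit_vec n j"] \<rho> P by auto
    then have c: "col \<rho> j = t \<cdot>\<^sub>v (P *\<^sub>v w)"
      using j P by (simp add: smult_mat_mult_vec[of _ n n])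
    then have "P *\<^sub>v col \<rho> j = t \<cdot>\<^sub>v (P * P *\<^sub>v w)"
      using P w by (simp add: mult_mat_vec[of _ n n] assoc_mult_mat_vec[of _ n n _ n])
    then have "P *\<^sub>v col \<rho> j = col \<rho> j" using PP c by simp
    then have "(P *\<^sub>v col \<rho> j) $ i = col \<rho> j $ i" by simp
    then show "(P * \<rho>) $$ (i, j) = \<rho> $$ (i, j)" using ij P \<rho> by simp
  qed (use P \<rho> in auto)
next
  assume e: "P * \<rho> = \<rho>"
  show "supp_le \<rho> (t \<cdot>\<^sub>m P)"
    unfolding supp_le_def
  proof
    fix v :: "complex vec" assume "v \<in> carrier_vec (dim_col \<rho>)"
    then have v: "v \<in> carrier_vec n" using \<rho> by simp
    have "(t \<cdot>\<^sub>m P) *\<^sub>v ((1 / t) \<cdot>\<^sub>v (\<rho> *\<^sub>v v)) = P * \<rho> *\<^sub>v v"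
      using P \<rho> v t by (simp add: smult_mat_mult_vec[of _ n n] mult_mat_vec[of _ n n]
          smult_smult_assoc assoc_mult_mat_vec[of _ n n _ n])
    then show "\<exists>w\<in>carrier_vec (dim_col (t \<cdot>\<^sub>m P)). \<rho> *\<^sub>v v = (t \<cdot>\<^sub>m P) *\<^sub>v w"
      using e P \<rho> v by (intro bexI[of _ "(1 / t) \<cdot>\<^sub>v (\<rho> *\<^sub>v v)"]) auto
  qed
qed

lemma ereal_ge_1_cases:
  assumes "(\<alpha> :: ereal) \<ge> 1"
  obtains "\<alpha> = 1" | "\<alpha> = \<infinity>" | a where "\<alpha> = ereal a" "a > 1"
  using assms by (cases \<alpha>) (auto simp: one_ereal_def order.order_iff_strict)

text \<open>\<open>P\<close> acts as the identity on \<rho> from both sides, so the sandwich only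
  rescales \<rho>; in each of the three branches the scale comes out as \<open>ln r\<close>.\<close>

lemma D_renyi_scaled_projection:
  assumes dens: "density n \<rho>" and P: "P \<in> carrier_mat n n" "projection P" and P\<rho>: "P * \<rho> = \<rho>"
    and r: "r > 0" and \<alpha>: "\<alpha> \<ge> 1" and n: "n > 0"
  shows "D_renyi \<alpha> \<rho> (of_real (1 / r) \<cdot>\<^sub>m P) = ereal (ln r - H_renyi \<alpha> \<rho>)"
proof -
  have \<rho>: "\<rho> \<in> carrier_mat n n" "mat_adjoint \<rho> = \<rho>" "tr \<rho> = 1"
    using dens psd_carrier psd_adjoint by (auto simp: density_def)
  have \<rho>P: "\<rho> * P = \<rho>"
    using arg_cong[OF P\<rho>, of mat_adjoint] mat_adjoint_mult[OF P(1) \<rho>(1)] \<rho>(2) P(2)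
    by (simp add: projection_def)
  have supp: "supp_le \<rho> (of_real (1 / r) \<cdot>\<^sub>m P)"
    using supp_le_scaled_projection[OF P \<rho>(1)] P\<rho> r by simp
  \<comment> \<open>Each side contributes \<open>(1 / r) powr s\<close>. At
    \<open>s = - 1 / 2\<close>, the order infinity, the factor is just \<open>r\<close>.\<close>
  have sandwich: "mpow (of_real (1 / r) \<cdot>\<^sub>m P) s * \<rho> * mpow (of_real (1 / r) \<cdot>\<^sub>m P) s
      = of_real (r powr (- 2 * s)) \<cdot>\<^sub>m \<rho>" for s
  proof -
    have "(1 / r) powr s * (1 / r) powr s = r powr (- 2 * s)"
      using r by (simp add: powr_divide powr_minus_divide flip: powr_add)
    then show ?thesis
      using P \<rho> P\<rho> \<rho>P unfolding mpow_def
      by (subst (1 2) mat_fun_scaled_projection[OF P])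
         (auto simp: mult_smult_assoc_mat[of _ n n _ n] mult_smult_distrib[of _ n n _ n] smult_smult_mat
           simp flip: of_real_mult)
  qed
  from \<alpha> show ?thesis
  proof (cases rule: ereal_ge_1_cases)
    case 1
    have l: "mlog (of_real (1 / r) \<cdot>\<^sub>m P) = of_real (- ln r) \<cdot>\<^sub>m P"
      unfolding mlog_def using r by (subst mat_fun_scaled_projection[OF P]) (auto simp: ln_div)
    have m: "mlog \<rho> \<in> carrier_mat n n" unfolding mlog_def by (rule mat_fun_carrier[OF \<rho>(1,2)])
    have "\<rho> * (mlog \<rho> - of_real (- ln r) \<cdot>\<^sub>m P) = \<rho> * mlog \<rho> - of_real (- ln r) \<cdot>\<^sub>m \<rho>"
      using \<rho> m P \<rho>P by (simp add: mult_minus_distrib_mat[of _ n n _ n] mult_smult_distrib[of _ n n _ n])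
    then have "tr (\<rho> * (mlog \<rho> - of_real (- ln r) \<cdot>\<^sub>m P)) = tr (\<rho> * mlog \<rho>) + of_real (ln r)"
      using \<rho> m by (simp add: tr_minus[of _ n] mult_carrier_mat[of _ n n _ n])
    then show ?thesis using supp 1 unfolding D_renyi_def H_renyi_def l by simp
  next
    case 2
    have "lmax (of_real (r powr 1) \<cdot>\<^sub>m \<rho>) = r * lmax \<rho>"
      using lmax_smult[OF \<rho>(1,2) n, of r] r by simp
    then show ?thesis
      using supp 2 r sandwich[of "- 1 / 2"] density_lmax_pos[OF dens]
      by (simp add: D_renyi_def H_renyi_def ln_mult)
  next
    case (3 a)
    define s where "s = (1 - a) / (2 * a)"
    \<comment> \<open>Raised to the power \<open>a\<close>, the scale becomes
      \<open>r powr (a - 1)\<close>; the prefactor \<open>1 / (a - 1)\<close> then leaves exactly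
      \<open>ln r\<close>.\<close>
    have e: "- 2 * s * a = a - 1" using 3 by (simp add: s_def field_simps)
    have m: "mpow \<rho> a \<in> carrier_mat n n" unfolding mpow_def by (rule mat_fun_carrier[OF \<rho>(1,2)])
    have "mpow (of_real (r powr (- 2 * s)) \<cdot>\<^sub>m \<rho>) a = of_real (r powr (a - 1)) \<cdot>\<^sub>m mpow \<rho> a"
      by (simp only: mpow_smult[OF \<rho>(1,2)] powr_powr e)
    then have "ln (Re (tr (mpow (of_real (r powr (- 2 * s)) \<cdot>\<^sub>m \<rho>) a)))
        = (a - 1) * ln r + ln (Re (tr (mpow \<rho> a)))"
      using density_tr_mpow_pos[OF dens, of a] r m by (simp add: ln_mult)
    then show ?thesis
      using supp 3 unfolding D_renyi_def H_renyi_def Let_def 3 real_of_ereal.simps s_def[symmetric] sandwich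
      by (simp add: one_ereal_def divide_simps) (simp add: algebra_simps)
  qed
qed

text \<open>The spectrum is uniform, \<open>1 / r\<close> repeated \<open>r\<close> times, and all
  Renyi entropies of a uniform distribution coincide.\<close>

lemma H_renyi_scaled_projection:
  assumes P: "P \<in> carrier_mat n n" "projection P" "tr P = of_real r"
    and r: "r > 0" and \<alpha>: "\<alpha> \<ge> 1" and n: "n > 0"
  shows "H_renyi \<alpha> (of_real (1 / r) \<cdot>\<^sub>m P) = ln r"
  using \<alpha>
proof (cases rule: ereal_ge_1_cases)
  case 1
  have l: "mlog (of_real (1 / r) \<cdot>\<^sub>m P) = of_real (- ln r) \<cdot>\<^sub>m P"
    unfolding mlog_def using r by (subst mat_fun_scaled_projection[OF P(1,2)]) (auto simp: ln_div)
  have "of_real (1 / r) \<cdot>\<^sub>m P * mlog (of_real (1 / r) \<cdot>\<^sub>m P) = of_real (- ln r / r) \<cdot>\<^sub>m P"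
    unfolding l using P by (simp add: mult_smult_assoc_mat[of _ n n _ n] mult_smult_distrib[of _ n n _ n]
        smult_smult_mat projection_def)
  then show ?thesis using 1 P r by (simp add: H_renyi_def)
next
  case 2
  obtain U lam where ud: "unitary_diag n P U lam" and lam: "\<forall>i<n. lam i = 0 \<or> lam i = 1"
    using projection_diag[OF P(1,2)] by blast
  have "complex_of_real (\<Sum>i<n. lam i) = of_real r"
    using tr_diag_conj[OF ud, of lam] unitary_diagD(4)[OF ud] P(3) by simp
  then have "(\<Sum>i<n. lam i) = r" using of_real_eq_iff by blast
  then obtain i where "i < n" "lam i = 1"
    using lam r sum.neutral[of "{..<n}" lam] by fastforce
  then have "Max (lam ` {..<n}) = 1"
    using lam by (intro Max_eqI) (auto simp: image_iff)
  then have "lmax P = 1" by (simp add: lmax_eq_Max[OF ud])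
  then have "lmax (of_real (1 / r) \<cdot>\<^sub>m P) = 1 / r"
    using P r n by (subst lmax_smult[of _ n]) (auto simp: projection_def)
  then show ?thesis using 2 r by (simp add: H_renyi_def ln_div)
next
  case (3 a)
  have "mpow (of_real (1 / r) \<cdot>\<^sub>m P) a = of_real ((1 / r) powr a) \<cdot>\<^sub>m P"
    unfolding mpow_def by (rule mat_fun_scaled_projection[OF P(1,2)]) auto
  then have "Re (tr (mpow (of_real (1 / r) \<cdot>\<^sub>m P) a)) = (1 / r) powr a * r"
    using P by simp
  also have "\<dots> = r powr (1 - a)" using r by (simp add: powr_divide powr_diff)
  finally show ?thesis using 3 r by (simp add: H_renyi_def one_ereal_def)
qed

section \<open>Averages of unitary matrices\<close>

lemma chi_add: "chi d (a + b) = chi d a * chi d b"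
  by (simp add: chi_def distrib_left add_divide_distrib exp_add)

lemma chi_0[simp]: "chi d 0 = 1" by (simp add: chi_def)

lemma chi_mult_nat: "chi d (int k * a) = chi d a ^ k"
  by (induction k) (simp_all add: chi_add distrib_right)

lemma chi_eq_cis: "chi d a = cis (2 * pi * of_int a / of_nat d)"
  by (simp add: chi_def cis_conv_exp mult_ac)

lemma cmod_chi[simp]: "cmod (chi d a) = 1"
  by (simp add: chi_eq_cis)

lemma chi_eq_1_iff:
  assumes "d > 0"
  shows "chi d a = 1 \<longleftrightarrow> int d dvd a"
proof
  assume "chi d a = 1"
  then have "cos (2 * pi * of_int a / of_nat d) = 1"
    by (metis chi_eq_cis cis.sel(1) one_complex.sel(1))
  then obtain n :: int where "2 * pi * of_int a / of_nat d = of_int n * 2 * pi"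
    unfolding cos_one_2pi_int by blast
  then have "real_of_int a = of_int (n * int d)" using assms by (simp add: field_simps)
  then show "int d dvd a" by (metis dvd_triv_right of_int_eq_iff)
next
  assume "int d dvd a"
  then obtain k where "a = int d * k" by blast
  then have "chi d a = cis (2 * pi * of_int k)" using assms by (simp add: chi_eq_cis mult_ac)
  then show "chi d a = 1" using cis_multiple_2pi[of "of_int k"] by simp
qed

text \<open>A geometric sum whose ratio is a d-th root of unity. It underlies the resolution of the
  identity by spectral projections as well as the trace and completeness relations of the Weyl
  operators.\<close>

lemma sum_chi:
  assumes "d > 0"
  shows "(\<Sum>k<d. chi d (int k * a)) = (if int d dvd a then of_nat d else 0)"
proof (cases "int d dvd a")
  case True
  then have "chi d a = 1" using chi_eq_1_iff[OF assms] by simp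
  then show ?thesis using True by (simp add: chi_mult_nat)
next
  case False
  then have "chi d a \<noteq> 1" using chi_eq_1_iff[OF assms] by simp
  moreover have "chi d a ^ d = 1"
    using chi_eq_1_iff[OF assms, of "int d * a"] by (simp add: chi_mult_nat)
  ultimately show ?thesis using False by (simp add: chi_mult_nat geometric_sum)
qed

section \<open>Sums and averages of matrices\<close>

text \<open>The zero matrix depends on the dimension, so the sum is formed entrywise at a fixed size
  \<open>n\<close>, which also settles the empty sum.\<close>

definition msum :: "nat \<Rightarrow> ('x \<Rightarrow> complex mat) \<Rightarrow> 'x set \<Rightarrow> complex mat" where
  "msum n f S = mat n n (\<lambda>(i, j). \<Sum>x\<in>S. f x $$ (i, j))"

lemma msum_carrier[simp]: "msum n f S \<in> carrier_mat n n"
  by (simp add: msum_def)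

lemma msum_index: "i < n \<Longrightarrow> j < n \<Longrightarrow> msum n f S $$ (i, j) = (\<Sum>x\<in>S. f x $$ (i, j))"
  by (simp add: msum_def)

lemma dim_msum[simp]: "dim_row (msum n f S) = n" "dim_col (msum n f S) = n"
  by (simp_all add: msum_def)

lemma msum_cong: "(\<And>x. x \<in> S \<Longrightarrow> f x = g x) \<Longrightarrow> msum n f S = msum n g S"
  by (simp add: msum_def)

lemma msum_mult_left:
  assumes "A \<in> carrier_mat n n" "\<And>x. x \<in> S \<Longrightarrow> f x \<in> carrier_mat n n"
  shows "A * msum n f S = msum n (\<lambda>x. A * f x) S"
proof (rule eq_matI)
  fix i j assume "i < dim_row (msum n (\<lambda>x. A * f x) S)" "j < dim_col (msum n (\<lambda>x. A * f x) S)"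
  then have ij: "i < n" "j < n" by auto
  have f: "(A * f x) $$ (i, j) = (\<Sum>k<n. A $$ (i, k) * f x $$ (k, j))" if "x \<in> S" for x
    using assms(1) assms(2)[OF that] ij by (subst mult_mat_index) auto
  have "(A * msum n f S) $$ (i, j) = (\<Sum>k<n. A $$ (i, k) * (\<Sum>x\<in>S. f x $$ (k, j)))"
    using assms(1) ij by (subst mult_mat_index) (auto simp: msum_index)
  also have "\<dots> = (\<Sum>x\<in>S. \<Sum>k<n. A $$ (i, k) * f x $$ (k, j))"
    by (simp add: sum_distrib_left) (rule sum.swap)
  finally show "(A * msum n f S) $$ (i, j) = msum n (\<lambda>x. A * f x) S $$ (i, j)"
    using ij f by (simp add: msum_index)
qed (use assms in auto)

lemma msum_adjoint:
  assumes "\<And>x. x \<in> S \<Longrightarrow> f x \<in> carrier_mat n n"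
  shows "mat_adjoint (msum n f S) = msum n (\<lambda>x. mat_adjoint (f x)) S"
proof -
  have "dim_row (f x) = n" "dim_col (f x) = n" if "x \<in> S" for x using assms[OF that] by auto
  then show ?thesis by (intro eq_matI) (auto simp: msum_index intro!: sum.cong)
qed

lemma msum_mult_right:
  assumes "A \<in> carrier_mat n n" "\<And>x. x \<in> S \<Longrightarrow> f x \<in> carrier_mat n n"
  shows "msum n f S * A = msum n (\<lambda>x. f x * A) S"
proof -
  have "mat_adjoint (msum n f S * A) = mat_adjoint (msum n (\<lambda>x. f x * A) S)"
    using assms by (simp add: msum_adjoint mat_adjoint_mult[of _ n n _ n] msum_mult_left
        mult_carrier_mat[of _ n n _ n] cong: msum_cong)
  then show ?thesis by (metis mat_adjoint_adjoint)
qed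

lemma tr_msum:
  assumes "\<And>x. x \<in> S \<Longrightarrow> f x \<in> carrier_mat n n"
  shows "tr (msum n f S) = (\<Sum>x\<in>S. tr (f x))"
proof -
  have "tr (f x) = (\<Sum>i<n. f x $$ (i, i))" if "x \<in> S" for x
    using assms[OF that] by (auto simp: tr_def)
  moreover have "tr (msum n f S) = (\<Sum>i<n. \<Sum>x\<in>S. f x $$ (i, i))"
    by (simp add: tr_def msum_index)
  ultimately show ?thesis by (simp add: sum.swap[of _ S])
qed

lemma msum_const: "A \<in> carrier_mat n n \<Longrightarrow> msum n (\<lambda>x. A) S = of_nat (card S) \<cdot>\<^sub>m A"
  by (intro eq_matI) (auto simp: msum_index)

lemma msum_reindex: "bij_betw h S T \<Longrightarrow> msum n (\<lambda>x. f (h x)) S = msum n f T"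
  by (intro eq_matI) (auto simp: msum_index intro: sum.reindex_bij_betw[of _ _ _ "\<lambda>y. f y $$ _"])

definition mavg :: "nat \<Rightarrow> ('x \<Rightarrow> complex mat) \<Rightarrow> 'x set \<Rightarrow> complex mat" where
  "mavg n f S = of_real (1 / real (card S)) \<cdot>\<^sub>m msum n f S"

lemma mavg_carrier[simp]: "mavg n f S \<in> carrier_mat n n"
  by (simp add: mavg_def)

lemma one_smult_mat[simp]: "1 \<cdot>\<^sub>m A = (A :: complex mat)"
  by (rule eq_matI) auto

lemma mavg_fix:
  assumes S: "finite S" "S \<noteq> {}" and f: "\<And>x. x \<in> S \<Longrightarrow> f x \<in> carrier_mat n n"
    and K: "K \<in> carrier_mat n n" "\<And>x. x \<in> S \<Longrightarrow> f x * K = K"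
  shows "mavg n f S * K = K"
proof -
  have "mavg n f S * K = of_real (1 / real (card S)) \<cdot>\<^sub>m msum n (\<lambda>x. f x * K) S"
    using K f by (simp add: mavg_def mult_smult_assoc_mat[of _ n n _ n] msum_mult_right)
  also have "msum n (\<lambda>x. f x * K) S = of_nat (card S) \<cdot>\<^sub>m K"
    using K by (simp add: msum_const cong: msum_cong)
  finally show ?thesis using S by (simp add: smult_smult_mat)
qed

text \<open>The average \<open>M\<close> satisfies \<open>M\<^sup>* M = M\<close>, which already gives both projection identities.\<close>
lemma mavg_projection:
  assumes S: "finite S" "S \<noteq> {}" and f: "\<And>x. x \<in> S \<Longrightarrow> f x \<in> carrier_mat n n"
    and u: "\<And>x. x \<in> S \<Longrightarrow> mat_adjoint (f x) * f x = 1\<^sub>m n"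
    and fixM: "\<And>x. x \<in> S \<Longrightarrow> f x * mavg n f S = mavg n f S"
  shows "projection (mavg n f S)"
proof -
  let ?M = "mavg n f S"
  have "mat_adjoint (f x) * ?M = ?M" if "x \<in> S" for x
  proof -
    have "mat_adjoint (f x) * (f x * ?M) = (mat_adjoint (f x) * f x) * ?M"
      using f[OF that] by (simp add: assoc_mult_mat[of _ n n _ n _ n])
    then show ?thesis using fixM[OF that] u[OF that] by (simp add: left_mult_one_mat[of _ n n])
  qed
  moreover have adj: "mat_adjoint ?M = mavg n (\<lambda>x. mat_adjoint (f x)) S"
    using f by (simp add: mavg_def msum_adjoint)
  ultimately have MM: "mat_adjoint ?M * ?M = ?M"
    unfolding adj using S f by (intro mavg_fix) auto
  have "mat_adjoint (mat_adjoint ?M * ?M) = mat_adjoint ?M * ?M"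
    by (subst mat_adjoint_mult[of _ n n _ n]) auto
  then have "mat_adjoint ?M = ?M" using MM by simp
  then show ?thesis using MM by (simp add: projection_def)
qed

section \<open>Star algebras and generated algebras\<close>

text \<open>The closure conditions of \<open>cstar_gen\<close> without the generators. A property of
  all generated matrices is proved by showing that the matrices having it form such an algebra. The
  identity is not among the conditions; it enters later as the Weyl operator of
  \<open>zero\<close>.\<close>

definition star_algebra :: "nat \<Rightarrow> complex mat set \<Rightarrow> bool" where
  "star_algebra N A \<longleftrightarrow> A \<subseteq> carrier_mat N N \<and>
      (\<forall>X \<in> A. \<forall>Y \<in> A. X + Y \<in> A \<and> X * Y \<in> A) \<and>
      (\<forall>c. \<forall>X \<in> A. c \<cdot>\<^sub>m X \<in> A) \<and> (\<forall>X \<in> A. mat_adjoint X \<in> A)"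

lemma star_algebraI:
  assumes "A \<subseteq> carrier_mat N N" "\<And>X Y. X \<in> A \<Longrightarrow> Y \<in> A \<Longrightarrow> X + Y \<in> A"
    "\<And>X Y. X \<in> A \<Longrightarrow> Y \<in> A \<Longrightarrow> X * Y \<in> A" "\<And>c X. X \<in> A \<Longrightarrow> c \<cdot>\<^sub>m X \<in> A"
    "\<And>X. X \<in> A \<Longrightarrow> mat_adjoint X \<in> A"
  shows "star_algebra N A"
  using assms by (auto simp: star_algebra_def)

lemma star_algebraD:
  assumes "star_algebra N A"
  shows "A \<subseteq> carrier_mat N N" "X \<in> A \<Longrightarrow> Y \<in> A \<Longrightarrow> X + Y \<in> A"
    "X \<in> A \<Longrightarrow> Y \<in> A \<Longrightarrow> X * Y \<in> A" "X \<in> A \<Longrightarrow> c \<cdot>\<^sub>m X \<in> A"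
    "X \<in> A \<Longrightarrow> mat_adjoint X \<in> A"
  using assms by (auto simp: star_algebra_def)

lemma cstar_gen_eq: "cstar_gen N T = \<Inter>{A. star_algebra N A \<and> T \<subseteq> A}"
  unfolding cstar_gen_def star_algebra_def by (rule arg_cong[where f = Inter]) auto

lemma cstar_gen_least: "star_algebra N A \<Longrightarrow> T \<subseteq> A \<Longrightarrow> cstar_gen N T \<subseteq> A"
  by (auto simp: cstar_gen_eq)

lemma cstar_gen_superset: "T \<subseteq> cstar_gen N T"
  by (auto simp: cstar_gen_eq)

lemma star_algebra_carrier: "star_algebra N (carrier_mat N N)"
  by (rule star_algebraI) (auto intro: mult_carrier_mat)

lemma star_algebra_cstar_gen:
  assumes "T \<subseteq> carrier_mat N N"
  shows "star_algebra N (cstar_gen N T)"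
proof (rule star_algebraI)
  show "cstar_gen N T \<subseteq> carrier_mat N N"
    using assms star_algebra_carrier by (rule_tac cstar_gen_least)
qed (auto simp: cstar_gen_eq dest: star_algebraD)

lemma msum_in_star_algebra:
  assumes A: "star_algebra N A" and S: "finite S" "S \<noteq> {}" "\<And>x. x \<in> S \<Longrightarrow> f x \<in> A"
  shows "msum N f S \<in> A"
  using S
proof (induction S rule: finite_ne_induct)
  case (singleton x)
  then have "msum N f {x} = f x"
    using star_algebraD(1)[OF A] by (intro eq_matI) (auto simp: msum_index)
  then show ?case using singleton by simp
next
  case (insert x F)
  then have "f x \<in> carrier_mat N N" using star_algebraD(1)[OF A] by auto
  then have "msum N f (insert x F) = f x + msum N f F"
    using insert by (intro eq_matI) (auto simp: msum_index)
  then show ?case using insert star_algebraD(2)[OF A] by simp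
qed

lemma mavg_in_star_algebra:
  assumes "star_algebra N A" "finite S" "S \<noteq> {}" "\<And>x. x \<in> S \<Longrightarrow> f x \<in> A"
  shows "mavg N f S \<in> A"
  unfolding mavg_def by (rule star_algebraD(4)[OF assms(1)], rule msum_in_star_algebra[OF assms])

lemma smult_mat_cancel:
  fixes R :: "complex mat"
  assumes "R \<in> carrier_mat n n" "R \<noteq> 0\<^sub>m n n" "a \<cdot>\<^sub>m R = b \<cdot>\<^sub>m R"
  shows "a = b"
proof -
  obtain i j where ij: "i < n" "j < n" "R $$ (i, j) \<noteq> 0"
    using assms(1,2) by (metis carrier_matD eq_matI index_zero_mat)
  then show ?thesis using arg_cong[OF assms(3), of "\<lambda>M. M $$ (i, j)"] assms(1) by auto
qed

section \<open>Minimal projections\<close>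

lemma unitary_pow:
  fixes U :: "complex mat"
  assumes "U \<in> carrier_mat n n" "mat_adjoint U * U = 1\<^sub>m n"
  shows "mat_adjoint (U ^\<^sub>m k) * (U ^\<^sub>m k) = 1\<^sub>m n"
proof (induction k)
  case 0
  then show ?case using assms by simp
next
  case (Suc k)
  have p: "U ^\<^sub>m k \<in> carrier_mat n n" using assms by simp
  have "mat_adjoint (U ^\<^sub>m Suc k) * (U ^\<^sub>m Suc k)
      = mat_adjoint U * (mat_adjoint (U ^\<^sub>m k) * U ^\<^sub>m k) * U"
    using p assms(1) by (simp add: mat_adjoint_mult[of _ n n _ n] assoc_mult_mat[of _ n n _ n _ n]
        mult_carrier_mat[of _ n n _ n])
  then show ?case using Suc assms by (simp add: right_mult_one_mat[of _ n n])
qed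

lemma smult_pow_mat:
  assumes "U \<in> carrier_mat n n"
  shows "(z \<cdot>\<^sub>m U) ^\<^sub>m k = (z :: complex) ^ k \<cdot>\<^sub>m U ^\<^sub>m k"
proof (induction k)
  case 0
  then show ?case using assms by (auto intro!: eq_matI)
next
  case (Suc k)
  have p: "U ^\<^sub>m k \<in> carrier_mat n n" using assms by simp
  show ?case using Suc assms p
    by (simp add: mult_smult_assoc_mat[of _ n n _ n] mult_smult_distrib[of _ n n _ n] smult_smult_mat mult_ac)
qed

text \<open>Multiplication by \<open>T\<close> permutes the powers \<open>T ^\<^sub>m 0\<close> to
  \<open>T ^\<^sub>m (d - 1)\<close> cyclically.\<close>

lemma root_average_fix:
  assumes T: "T \<in> carrier_mat n n" "T ^\<^sub>m d = 1\<^sub>m n"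
  shows "T * mavg n (\<lambda>j. T ^\<^sub>m j) {..<d} = mavg n (\<lambda>j. T ^\<^sub>m j) {..<d}"
proof -
  have comm: "T * T ^\<^sub>m j = T ^\<^sub>m Suc j" for j
  proof (induction j)
    case 0
    then show ?case using T by (simp add: left_mult_one_mat[of _ n n] right_mult_one_mat[of _ n n])
  next
    case (Suc j)
    then show ?case using T(1) assoc_mult_mat[of T n n "T ^\<^sub>m j" n T n] by simp
  qed
  have "T * msum n (\<lambda>j. T ^\<^sub>m j) {..<d} = msum n (\<lambda>j. T ^\<^sub>m Suc j) {..<d}"
    using T(1) by (simp only: msum_mult_left pow_carrier_mat comm)
  also have "\<dots> = msum n (\<lambda>j. T ^\<^sub>m j) {..<d}"
  proof (rule eq_matI)
    fix a b assume "a < dim_row (msum n (\<lambda>j. T ^\<^sub>m j) {..<d})" "b < dim_col (msum n (\<lambda>j. T ^\<^sub>m j) {..<d})"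
    then have ab: "a < n" "b < n" by auto
    \<comment> \<open>The shifted sum differs only by losing the term 0 and gaining the term
      \<open>d\<close>, and these agree.\<close>
    have "T ^\<^sub>m 0 = T ^\<^sub>m d" using T by simp
    then have "(\<Sum>j<d. (T ^\<^sub>m Suc j) $$ (a, b)) = (\<Sum>j<d. (T ^\<^sub>m j) $$ (a, b))"
      using sum.lessThan_Suc_shift[of "\<lambda>j. (T ^\<^sub>m j) $$ (a, b)" d]
        sum.lessThan_Suc[of "\<lambda>j. (T ^\<^sub>m j) $$ (a, b)" d] by (simp only:) (simp add: algebra_simps)
    then show "msum n (\<lambda>j. T ^\<^sub>m Suc j) {..<d} $$ (a, b) = msum n (\<lambda>j. T ^\<^sub>m j) {..<d} $$ (a, b)"
      using ab by (simp only: msum_index)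
  qed auto
  finally show ?thesis
    using T(1) by (simp add: mavg_def mult_smult_distrib[of _ n n _ n])
qed

text \<open>The spectral projections of \<open>U\<close> lie in the algebra and sum to the identity, so the minimal
  projection lies below exactly one of them.\<close>
lemma minimal_projection_eigen:
  assumes d: "d > 0" and U: "U \<in> carrier_mat n n" "mat_adjoint U * U = 1\<^sub>m n"
    and Ud: "U ^\<^sub>m d = c \<cdot>\<^sub>m 1\<^sub>m n" "cmod c = 1"
    and A: "star_algebra n A" "U \<in> A" "1\<^sub>m n \<in> A"
    and P: "minimal_projection n A P" and comm: "U * P = P * U"
  shows "\<exists>l. U * P = l \<cdot>\<^sub>m P"
proof -
  note assoc = assoc_mult_mat[of _ n n _ n _ n] and mc = mult_carrier_mat[of _ n n _ n]
  note sm = mult_smult_assoc_mat[of _ n n _ n] mult_smult_distrib[of _ n n _ n] smult_smult_mat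
  have Pc: "P \<in> carrier_mat n n" "P \<in> A" "mat_adjoint P = P" "P * P = P" "P \<noteq> 0\<^sub>m n n"
    using P star_algebraD(1)[OF A(1)] by (auto simp: minimal_projection_def projection_def)
  have "c \<noteq> 0" using Ud(2) by auto
  then have "card {z. z ^ d = 1 / c} = d" using d by (intro card_nth_roots) auto
  then have "{z. z ^ d = 1 / c} \<noteq> {}" using d by (metis card.empty less_irrefl)
  \<comment> \<open>\<open>U ^\<^sub>m d\<close> is only a scalar \<open>c\<close>; rescaling by a
    d-th root of \<open>1 / c\<close> makes the power equal to 1. The numbers \<open>z k\<close> run
    through all such roots.\<close>
  then obtain z0 where z0: "z0 ^ d = 1 / c" by blast
  have "cmod z0 ^ d = 1" using z0 Ud(2) by (simp add: norm_divide flip: norm_power)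
  then have z0n: "cmod z0 = 1" using d by (intro power_eq_imp_eq_base[of "cmod z0" d 1]) auto
  define z where "z k = z0 * chi d (int k)" for k
  define T where "T k = z k \<cdot>\<^sub>m U" for k
  \<comment> \<open>The spectral projection of \<open>U\<close> for the eigenvalue
    \<open>cnj (z k)\<close>, the inverse of \<open>z k\<close>.\<close>
  define Q where "Q k = mavg n (\<lambda>j. T k ^\<^sub>m j) {..<d}" for k
  have ne: "{..<d} \<noteq> {}" using d by auto
  have T: "T k \<in> carrier_mat n n" for k using U by (simp add: T_def)
  have zz: "z k * cnj (z k) = 1" for k
    using complex_norm_square[of "z k"] by (simp add: z_def norm_mult z0n)
  have Tu: "mat_adjoint (T k) * T k = 1\<^sub>m n" for k
    using U zz[of k] by (auto simp: T_def sm mult.commute intro!: eq_matI)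
  have "chi d (int k) ^ d = 1" for k
    using chi_eq_1_iff[OF d, of "int d * int k"] by (simp add: chi_mult_nat)
  then have zd: "z k ^ d = 1 / c" for k by (simp add: z_def power_mult_distrib z0)
  have Td: "T k ^\<^sub>m d = 1\<^sub>m n" for k
    using Ud(1) zd[of k] \<open>c \<noteq> 0\<close> U by (auto simp: T_def smult_pow_mat smult_smult_mat intro!: eq_matI)
  have Qc[simp]: "Q k \<in> carrier_mat n n" for k by (simp add: Q_def)
  have TQ: "T k * Q k = Q k" for k unfolding Q_def by (rule root_average_fix[OF T Td])
  have TjQ: "T k ^\<^sub>m j * Q k = Q k" for k j
    by (induction j) (use T TQ carrier_matD[OF T] in \<open>auto simp: assoc left_mult_one_mat[of _ n n]\<close>)
  have Qp: "projection (Q k)" for k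
    unfolding Q_def using d ne T Tu TjQ[unfolded Q_def] unitary_pow[OF T Tu]
    by (intro mavg_projection) auto
  have Ta: "T k ^\<^sub>m j \<in> A" for k j
  proof (induction j)
    case 0
    then show ?case using A(3) T[of k] by simp
  next
    case (Suc j)
    moreover have "T k \<in> A" unfolding T_def by (rule star_algebraD(4)[OF A(1,2)])
    ultimately show ?case using star_algebraD(3)[OF A(1)] by simp
  qed
  have Qa: "Q k \<in> A" for k
    unfolding Q_def using ne Ta by (intro mavg_in_star_algebra[OF A(1)]) auto
  have TP: "T k ^\<^sub>m j * P = P * T k ^\<^sub>m j" for k j
  proof (induction j)
    case 0
    then show ?case using Pc T[of k] by (simp add: left_mult_one_mat[of _ n n] right_mult_one_mat[of _ n n])
  next
    case (Suc j)
    have t: "T k * P = P * T k" using U Pc comm by (simp add: T_def sm)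
    have "T k ^\<^sub>m Suc j * P = T k ^\<^sub>m j * (P * T k)" using T Pc t by (simp add: assoc)
    also have "\<dots> = P * T k ^\<^sub>m Suc j"
      using T Pc Suc by (simp add: mc flip: assoc)
    finally show ?case .
  qed
  have QP: "Q k * P = P * Q k" for k
    using T Pc TP unfolding Q_def mavg_def
    by (simp add: sm msum_mult_left msum_mult_right cong: msum_cong)
  have "\<exists>k<d. Q k * P \<noteq> 0\<^sub>m n n"
  proof (rule ccontr)
    assume "\<not> ?thesis"
    then have 0: "Q k * P = 0\<^sub>m n n" if "k < d" for k using that by blast
    \<comment> \<open>Character orthogonality: when the \<open>Q k\<close> are added up, every power
      of \<open>U\<close> except the zeroth cancels.\<close>
    have s: "(\<Sum>k<d. z k ^ j) = (if j = 0 then of_nat d else 0)" if "j < d" for j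
    proof -
      have "(\<Sum>k<d. z k ^ j) = z0 ^ j * (\<Sum>k<d. chi d (int k * int j))"
        by (simp add: z_def power_mult_distrib sum_distrib_left mult.commute[of _ "int j"] chi_mult_nat)
      then show ?thesis using sum_chi[OF d, of "int j"] that
        by (auto dest: dvd_imp_le)
    qed
    have "msum n Q {..<d} = 1\<^sub>m n"
    proof (rule eq_matI)
      fix a b assume "a < dim_row (1\<^sub>m n)" "b < dim_col (1\<^sub>m n)"
      then have ab: "a < n" "b < n" by auto
      have "msum n Q {..<d} $$ (a, b) = (\<Sum>k<d. \<Sum>j<d. (1 / of_nat d) * (z k ^ j * (U ^\<^sub>m j) $$ (a, b)))"
        using ab U T by (simp add: msum_index Q_def mavg_def T_def smult_pow_mat sum_distrib_left)
      also have "\<dots> = (\<Sum>j<d. (1 / of_nat d) * (\<Sum>k<d. z k ^ j) * (U ^\<^sub>m j) $$ (a, b))"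
        by (subst sum.swap) (simp add: sum_distrib_left sum_distrib_right mult_ac)
      also have "\<dots> = (\<Sum>j<d. if j = 0 then (U ^\<^sub>m 0) $$ (a, b) else 0)"
        using d by (intro sum.cong refl) (auto simp: s)
      also have "\<dots> = 1\<^sub>m n $$ (a, b)" using U d by simp
      finally show "msum n Q {..<d} $$ (a, b) = 1\<^sub>m n $$ (a, b)" .
    qed auto
    then have "P = msum n Q {..<d} * P" using Pc by (simp add: left_mult_one_mat[of _ n n])
    also have "\<dots> = msum n (\<lambda>k. Q k * P) {..<d}" using Pc by (simp add: msum_mult_right)
    also have "\<dots> = 0\<^sub>m n n" by (intro eq_matI) (auto simp: msum_index 0)
    finally show False using Pc by simp
  qed
  then obtain k where k: "Q k * P \<noteq> 0\<^sub>m n n" by blast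
  have q: "mat_adjoint (Q k) = Q k" "Q k * Q k = Q k" using Qp by (auto simp: projection_def)
  \<comment> \<open>Because \<open>Q k\<close> and \<open>P\<close> commute, their product is a
    projection below \<open>P\<close>; being nonzero, it equals \<open>P\<close> by
    minimality.\<close>
  have "projection (Q k * P)"
    unfolding projection_def
  proof
    show "mat_adjoint (Q k * P) = Q k * P"
      using Pc q QP by (simp add: mat_adjoint_mult[of _ n n _ n])
    have "Q k * P * (Q k * P) = Q k * (P * Q k) * P" using Pc by (simp add: assoc mc)
    also have "\<dots> = (Q k * Q k) * (P * P)" unfolding QP[symmetric] using Pc(1) by (simp add: assoc mc)
    finally show "Q k * P * (Q k * P) = Q k * P" using q Pc by simp
  qed
  moreover have "Q k * P \<in> A" using star_algebraD(3)[OF A(1)] Qa Pc by blast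
  moreover have "Q k * P * P = Q k * P" using Pc by (simp add: assoc)
  ultimately have QkP: "Q k * P = P" using P k by (auto simp: minimal_projection_def)
  have "T k * P = P" using TQ[of k] T[of k] Pc QkP by (metis assoc Qc)
  then have "cnj (z k) \<cdot>\<^sub>m (z k \<cdot>\<^sub>m (U * P)) = cnj (z k) \<cdot>\<^sub>m P"
    using U Pc by (simp add: T_def sm)
  then have "U * P = cnj (z k) \<cdot>\<^sub>m P"
    using zz[of k] by (simp add: smult_smult_mat mult.commute[of "cnj _"])
  then show ?thesis by blast
qed

section \<open>Stabilizer projections of an abstract Weyl system\<close>

text \<open>What the stabilizer argument needs: unitaries that multiply like a finite commutative
  group up to phases, with trace zero away from the neutral label. Phases stay existential, so no
  explicit cocycle is carried around. Cancellation on the finite set \<open>V\<close> takes the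
  place of inverses.\<close>

locale weyl_system =
  fixes N d :: nat and V :: "'x set" and add :: "'x \<Rightarrow> 'x \<Rightarrow> 'x" and zero :: 'x
    and W :: "'x \<Rightarrow> complex mat"
  assumes N_pos: "N > 0" and d_pos: "d > 0" and finite_V: "finite V"
    and zero_V: "zero \<in> V"
    and add_commute: "x \<in> V \<Longrightarrow> y \<in> V \<Longrightarrow> add x y = add y x"
    and add_V: "x \<in> V \<Longrightarrow> y \<in> V \<Longrightarrow> add x y \<in> V"
    and add_cancel: "x \<in> V \<Longrightarrow> y \<in> V \<Longrightarrow> z \<in> V \<Longrightarrow> add x y = add x z \<Longrightarrow> y = z"
    and W_carrier[simp]: "W x \<in> carrier_mat N N"
    and W_unitary: "x \<in> V \<Longrightarrow> mat_adjoint (W x) * W x = 1\<^sub>m N"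
    and W_zero: "W zero = 1\<^sub>m N"
    and W_mult: "x \<in> V \<Longrightarrow> y \<in> V \<Longrightarrow> \<exists>c. cmod c = 1 \<and> W x * W y = c \<cdot>\<^sub>m W (add x y)"
    and W_pow: "x \<in> V \<Longrightarrow> \<exists>c. cmod c = 1 \<and> W x ^\<^sub>m d = c \<cdot>\<^sub>m 1\<^sub>m N"
    and tr_W: "x \<in> V \<Longrightarrow> x \<noteq> zero \<Longrightarrow> tr (W x) = 0"
begin

definition abelian :: "'x set \<Rightarrow> bool" where
  "abelian S \<longleftrightarrow> S \<subseteq> V \<and> zero \<in> S \<and>
     (\<forall>x \<in> S. \<forall>y \<in> S. add x y \<in> S \<and> W x * W y = W y * W x)"

text \<open>The operators \<open>cnj (l x) W x\<close> fix every joint eigenvector with eigenvalues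
  \<open>l\<close>. If \<open>l\<close> is realised by a nonzero matrix, their average is the
  projection onto that joint eigenspace.\<close>

definition stab_proj :: "'x set \<Rightarrow> ('x \<Rightarrow> complex) \<Rightarrow> complex mat" where
  "stab_proj S l = mavg N (\<lambda>x. cnj (l x) \<cdot>\<^sub>m W x) S"

lemmas assoc = assoc_mult_mat[of _ N N _ N _ N]
lemmas mc = mult_carrier_mat[of _ N N _ N]
lemmas sm = mult_smult_assoc_mat[of _ N N _ N] mult_smult_distrib[of _ N N _ N] smult_smult_mat
lemmas one = left_mult_one_mat[of _ N N] right_mult_one_mat[of _ N N]

lemma W_cancel: "x \<in> V \<Longrightarrow> K \<in> carrier_mat N N \<Longrightarrow> mat_adjoint (W x) * (W x * K) = K"
  using W_unitary[of x] by (simp add: one flip: assoc)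

lemma W_unitary': "x \<in> V \<Longrightarrow> W x * mat_adjoint (W x) = 1\<^sub>m N"
  using W_unitary[of x] mat_mult_left_right_inverse[of "mat_adjoint (W x)" N "W x"] by simp

lemma eigen_adjoint:
  assumes "x \<in> V" "K \<in> carrier_mat N N" "W x * K = l \<cdot>\<^sub>m K" "cmod l = 1"
  shows "mat_adjoint (W x) * K = cnj l \<cdot>\<^sub>m K"
proof -
  have l: "cnj l * l = 1" using assms(4) complex_norm_square[of l] by (simp add: mult.commute)
  have "cnj l \<cdot>\<^sub>m (mat_adjoint (W x) * (l \<cdot>\<^sub>m K)) = cnj l \<cdot>\<^sub>m K"
    using W_cancel[OF assms(1,2)] assms(3) by simp
  then show ?thesis using assms(2) l by (simp add: sm)
qed

text \<open>A unitary factor leaves \<open>R\<^sup>* R\<close> unchanged, while the eigenvalue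
  multiplies it by the square of its modulus.\<close>

lemma eigen_cmod:
  assumes x: "x \<in> V" and R: "R \<in> carrier_mat N N" "R \<noteq> 0\<^sub>m N N" "W x * R = l \<cdot>\<^sub>m R"
  shows "cmod l = 1"
proof -
  have RR: "mat_adjoint R * R \<in> carrier_mat N N" using R by (simp add: mc)
  have RR0: "mat_adjoint R * R \<noteq> 0\<^sub>m N N"
  proof
    assume "mat_adjoint R * R = 0\<^sub>m N N"
    then have "tr (mat_adjoint R * mat_adjoint (mat_adjoint R)) = 0" by (simp add: tr_def)
    then have "mat_adjoint R = 0\<^sub>m N N" using tr_self_adjoint_eq_0[of "mat_adjoint R" N N] R by simp
    then have "mat_adjoint (mat_adjoint R) = 0\<^sub>m N N" by (auto intro!: eq_matI)
    then show False using R by simp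
  qed
  have "1 \<cdot>\<^sub>m (mat_adjoint R * R) = mat_adjoint R * (mat_adjoint (W x) * (W x * R))"
    using W_cancel[OF x R(1)] by simp
  also have "\<dots> = mat_adjoint (W x * R) * (W x * R)"
    using R(1) by (simp add: mat_adjoint_mult[of _ N N _ N] assoc mc)
  also have "\<dots> = (cnj l * l) \<cdot>\<^sub>m (mat_adjoint R * R)"
    unfolding R(3) using R(1) by (simp add: sm mult.commute)
  finally have "cnj l * l = 1" using smult_mat_cancel[OF RR RR0] by metis
  then have "complex_of_real ((cmod l)\<^sup>2) = 1" using complex_norm_square[of l] by (simp add: mult.commute)
  then have "(cmod l)\<^sup>2 = 1" using of_real_eq_1_iff by blast
  then show ?thesis by (simp add: power2_eq_1_iff) (metis norm_ge_zero neg_0_le_iff_le not_one_le_zero)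
qed

text \<open>An injective self-map of a finite set is onto; this supplies both reindexing and
  inverses inside \<open>S\<close>.\<close>

lemma translation_bij:
  assumes "abelian S" "y \<in> S"
  shows "bij_betw (add y) S S"
proof -
  have "inj_on (add y) S" using assms add_cancel by (auto simp: inj_on_def abelian_def subset_iff)
  moreover have "add y ` S \<subseteq> S" using assms by (auto simp: abelian_def)
  moreover have "finite S" using assms finite_V finite_subset by (auto simp: abelian_def)
  ultimately show ?thesis by (simp add: bij_betw_def endo_inj_surj)
qed

text \<open>\<open>R\<close> certifies that the phases \<open>l\<close> are consistent. It is
  instantiated by a minimal projection of the algebra of \<open>S\<close>, and by \<rho> itself for
  the stabilizer of \<rho>.\<close>

context
  fixes S l R
  assumes S: "abelian S" and R: "R \<in> carrier_mat N N" "R \<noteq> 0\<^sub>m N N"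
    and eig: "\<And>x. x \<in> S \<Longrightarrow> W x * R = l x \<cdot>\<^sub>m R"
begin

private lemma S_V: "x \<in> S \<Longrightarrow> x \<in> V" and zero_S: "zero \<in> S"
  and add_S: "x \<in> S \<Longrightarrow> y \<in> S \<Longrightarrow> add x y \<in> S" and S_ne: "S \<noteq> {}"
  using S by (auto simp: abelian_def)

private lemma S_finite: "finite S"
  using S finite_V finite_subset by (auto simp: abelian_def)

private lemma l_cmod: "x \<in> S \<Longrightarrow> cmod (l x) = 1"
  using eigen_cmod[OF S_V R eig] .

private lemma l_cnj: "x \<in> S \<Longrightarrow> cnj (l x) * l x = 1"
  using l_cmod complex_norm_square[of "l x"] by (simp add: mult.commute)

text \<open>Evaluating the product relation on \<open>R\<close> shows that \<open>l\<close> has the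
  same product phases as \<open>W\<close>, so in \<open>cnj (l x) W x\<close> they cancel.\<close>

private lemma l_mult:
  assumes "x \<in> S" "y \<in> S" "W x * W y = c \<cdot>\<^sub>m W (add x y)"
  shows "l x * l y = c * l (add x y)"
proof -
  have "(l x * l y) \<cdot>\<^sub>m R = W x * W y * R"
    using assms(1,2) eig R(1) by (simp add: assoc sm mult.commute)
  also have "\<dots> = (c * l (add x y)) \<cdot>\<^sub>m R"
    unfolding assms(3) using assms add_S eig R by (simp add: sm)
  finally show ?thesis by (rule smult_mat_cancel[OF R])
qed

lemma stab_proj_carrier[simp]: "stab_proj S l \<in> carrier_mat N N"
  by (simp add: stab_proj_def)

text \<open>Invariance of a group average: multiplying by \<open>W y\<close> translates the index by
  \<open>y\<close>, and \<open>l_mult\<close> accounts for the phase.\<close>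

lemma stab_proj_eigen:
  assumes y: "y \<in> S"
  shows "W y * stab_proj S l = l y \<cdot>\<^sub>m stab_proj S l"
proof -
  have "W y * (cnj (l x) \<cdot>\<^sub>m W x) = l y \<cdot>\<^sub>m (cnj (l (add y x)) \<cdot>\<^sub>m W (add y x))" if x: "x \<in> S" for x
  proof -
    obtain c where c: "cmod c = 1" "W y * W x = c \<cdot>\<^sub>m W (add y x)" using W_mult S_V x y by meson
    have cc: "cnj c * c = 1" using c complex_norm_square[of c] by (simp add: mult.commute)
    have yx: "add y x \<in> S" using add_S x y by simp
    have m: "l y * l x = c * l (add y x)" by (rule l_mult[OF y x c(2)])
    have "l y * cnj (l (add y x)) = l y * cnj (l (add y x)) * (cnj c * c)" by (simp add: cc)
    also have "\<dots> = l y * c * cnj (c * l (add y x))" by simp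
    also have "\<dots> = c * cnj (l x) * (cnj (l y) * l y)" unfolding m[symmetric] by simp
    also have "\<dots> = cnj (l x) * c" using l_cnj[OF y] by simp
    finally show ?thesis using c by (simp add: sm mult.commute)
  qed
  then have "W y * msum N (\<lambda>x. cnj (l x) \<cdot>\<^sub>m W x) S
      = msum N (\<lambda>x. l y \<cdot>\<^sub>m (cnj (l (add y x)) \<cdot>\<^sub>m W (add y x))) S"
    by (simp add: msum_mult_left cong: msum_cong)
  also have "\<dots> = msum N (\<lambda>x. l y \<cdot>\<^sub>m (cnj (l x) \<cdot>\<^sub>m W x)) S"
    by (rule msum_reindex[OF translation_bij[OF S y]])
  also have "\<dots> = l y \<cdot>\<^sub>m msum N (\<lambda>x. cnj (l x) \<cdot>\<^sub>m W x) S"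
    using carrier_matD[OF W_carrier] by (intro eq_matI) (auto simp: msum_index sum_distrib_left)
  finally show ?thesis by (simp add: stab_proj_def mavg_def sm mult.commute)
qed

lemma stab_proj_fix:
  assumes "K \<in> carrier_mat N N" "\<And>x. x \<in> S \<Longrightarrow> W x * K = l x \<cdot>\<^sub>m K"
  shows "stab_proj S l * K = K"
  unfolding stab_proj_def using S_finite S_ne assms l_cnj by (intro mavg_fix) (auto simp: sm)

lemma stab_proj_projection: "projection (stab_proj S l)"
proof -
  have "mat_adjoint (cnj (l x) \<cdot>\<^sub>m W x) * (cnj (l x) \<cdot>\<^sub>m W x) = 1\<^sub>m N" if "x \<in> S" for x
    using that l_cnj[OF that] W_unitary[OF S_V[OF that]] by (simp add: sm)
  moreover have "(cnj (l x) \<cdot>\<^sub>m W x) * stab_proj S l = stab_proj S l" if "x \<in> S" for x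
    using stab_proj_eigen[OF that] l_cnj[OF that] by (simp add: sm)
  ultimately show ?thesis
    unfolding stab_proj_def using S_finite S_ne by (intro mavg_projection) auto
qed

lemma stab_proj_adjoint: "mat_adjoint (stab_proj S l) = stab_proj S l"
  using stab_proj_projection by (simp add: projection_def)

lemma stab_proj_nonzero: "stab_proj S l \<noteq> 0\<^sub>m N N"
  using stab_proj_fix[OF R(1) eig] R by auto

text \<open>Only the term at \<open>zero\<close> has a trace, and acting on \<open>R\<close> the
  identity forces \<open>l zero = 1\<close>.\<close>

lemma tr_stab_proj: "tr (stab_proj S l) = of_real (real N / real (card S))"
proof -
  have "1 \<cdot>\<^sub>m R = l zero \<cdot>\<^sub>m R" using eig[OF zero_S] W_zero R by (simp add: one)
  then have l0: "l zero = 1" using smult_mat_cancel[OF R] by metis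
  have "tr (msum N (\<lambda>x. cnj (l x) \<cdot>\<^sub>m W x) S) = (\<Sum>x\<in>S. cnj (l x) * tr (W x))"
    by (simp add: tr_msum tr_smult[of _ N])
  also have "\<dots> = (\<Sum>x\<in>S. if x = zero then of_nat N else 0)"
    using S_V tr_W W_zero l0 by (intro sum.cong) auto
  also have "\<dots> = of_nat N" using S_finite zero_S by simp
  finally show ?thesis by (simp add: stab_proj_def mavg_def tr_smult[of _ N])
qed

lemma rank_stab_proj: "real (mat_rank N (stab_proj S l)) = real N / real (card S)"
  using rank_projection[OF stab_proj_carrier stab_proj_projection] tr_stab_proj
  by (metis of_real_eq_iff of_real_of_nat_eq)

text \<open>Up to normalization and the sign of the label this is the characteristic function of the
  stabilizer state: \<open>l\<close> on \<open>S\<close> and 0 elsewhere.\<close>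

lemma tr_stab_proj_W:
  assumes y: "y \<in> V"
  shows "tr (stab_proj S l * W y) = (if y \<in> S then of_real (real N / real (card S)) * l y else 0)"
proof (cases "y \<in> S")
  case True
  have "tr (stab_proj S l * W y) = tr (W y * stab_proj S l)" by (rule tr_mult_commute[of _ N N]) auto
  then show ?thesis using True tr_stab_proj by (simp add: stab_proj_eigen tr_smult[of _ N])
next
  case False
  have 0: "tr (W x * W y) = 0" if x: "x \<in> S" for x
  proof -
    obtain c where c: "W x * W y = c \<cdot>\<^sub>m W (add x y)" using W_mult S_V x y by meson
    \<comment> \<open>The inverse of \<open>x\<close> lies in \<open>S\<close>, so a
      \<open>y\<close> outside \<open>S\<close> cannot cancel \<open>x\<close>.\<close>
    obtain y' where y': "y' \<in> S" "add x y' = zero"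
      using translation_bij[OF S x] zero_S by (metis bij_betw_imp_surj_on imageE)
    have "add x y \<noteq> zero" using add_cancel[of x y y'] S_V x y y' False by auto
    then show ?thesis using c tr_W add_V S_V x y by (simp add: tr_smult[of _ N])
  qed
  have "msum N (\<lambda>x. cnj (l x) \<cdot>\<^sub>m W x) S * W y = msum N (\<lambda>x. cnj (l x) \<cdot>\<^sub>m (W x * W y)) S"
    by (simp add: msum_mult_right sm)
  then have "tr (stab_proj S l * W y)
      = of_real (1 / real (card S)) * (\<Sum>x\<in>S. cnj (l x) * tr (W x * W y))"
    by (simp add: stab_proj_def mavg_def sm tr_smult[of _ N] tr_msum mc)
  then show ?thesis using False 0 by simp
qed

text \<open>The matrices acting on the projection by one and the same scalar from both sides form a
  star algebra containing the generators. Asking for both sides makes the condition stable under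
  adjoints.\<close>

lemma cstar_gen_stab_proj:
  assumes "X \<in> cstar_gen N (W ` S)"
  shows "\<exists>c. X * stab_proj S l = c \<cdot>\<^sub>m stab_proj S l \<and> stab_proj S l * X = c \<cdot>\<^sub>m stab_proj S l"
proof -
  let ?E = "stab_proj S l"
  define A where "A = {X \<in> carrier_mat N N. \<exists>c. X * ?E = c \<cdot>\<^sub>m ?E \<and> ?E * X = c \<cdot>\<^sub>m ?E}"
  have "star_algebra N A"
  proof (rule star_algebraI)
    fix X Y assume X: "X \<in> A" and Y: "Y \<in> A"
    from X obtain a where a: "X \<in> carrier_mat N N" "X * ?E = a \<cdot>\<^sub>m ?E" "?E * X = a \<cdot>\<^sub>m ?E"
      by (auto simp: A_def)
    from Y obtain b where b: "Y \<in> carrier_mat N N" "Y * ?E = b \<cdot>\<^sub>m ?E" "?E * Y = b \<cdot>\<^sub>m ?E"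
      by (auto simp: A_def)
    have "(X + Y) * ?E = (a + b) \<cdot>\<^sub>m ?E" "?E * (X + Y) = (a + b) \<cdot>\<^sub>m ?E"
      using a b by (simp_all add: add_mult_distrib_mat[of _ N N _ _ N] mult_add_distrib_mat[of _ N N _ N]
          add_smult_distrib_right_mat[of _ N N])
    then show "X + Y \<in> A" using a b by (auto simp: A_def)
    have "X * Y * ?E = (a * b) \<cdot>\<^sub>m ?E"
      using a b by (simp add: assoc sm mult.commute)
    moreover have "?E * (X * Y) = (a * b) \<cdot>\<^sub>m ?E"
      using a b by (simp add: sm flip: assoc)
    ultimately show "X * Y \<in> A" using a b by (auto simp: A_def mc)
  next
    fix c X assume "X \<in> A"
    then show "c \<cdot>\<^sub>m X \<in> A" by (auto simp: A_def sm)
  next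
    fix X assume "X \<in> A"
    then obtain a where a: "X \<in> carrier_mat N N" "X * ?E = a \<cdot>\<^sub>m ?E" "?E * X = a \<cdot>\<^sub>m ?E"
      by (auto simp: A_def)
    have "mat_adjoint X * ?E = cnj a \<cdot>\<^sub>m ?E"
      using arg_cong[OF a(3), of mat_adjoint] a(1) stab_proj_adjoint by (simp add: mat_adjoint_mult[of _ N N _ N])
    moreover have "?E * mat_adjoint X = cnj a \<cdot>\<^sub>m ?E"
      using arg_cong[OF a(2), of mat_adjoint] a(1) stab_proj_adjoint by (simp add: mat_adjoint_mult[of _ N N _ N])
    ultimately show "mat_adjoint X \<in> A" using a by (auto simp: A_def)
  qed (auto simp: A_def)
  moreover have "W ` S \<subseteq> A"
  proof
    fix X assume "X \<in> W ` S"
    then obtain x where x: "x \<in> S" "X = W x" by blast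
    have "mat_adjoint (W x) * ?E = cnj (l x) \<cdot>\<^sub>m ?E"
      by (rule eigen_adjoint[OF S_V[OF x(1)] _ stab_proj_eigen l_cmod]) (use x in auto)
    then have "mat_adjoint (mat_adjoint (W x) * ?E) = l x \<cdot>\<^sub>m ?E"
      using stab_proj_adjoint by simp
    then have "?E * W x = l x \<cdot>\<^sub>m ?E" using stab_proj_adjoint by (simp add: mat_adjoint_mult[of _ N N _ N])
    then show "X \<in> A" using x stab_proj_eigen by (auto simp: A_def)
  qed
  ultimately have "cstar_gen N (W ` S) \<subseteq> A" by (rule cstar_gen_least)
  then show ?thesis using assms by (auto simp: A_def)
qed

text \<open>By \<open>cstar_gen_stab_proj\<close> a projection \<open>Q\<close> of the algebra below
  \<open>E\<close> is \<open>c E\<close>, and idempotence leaves \<open>c = 0\<close> or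
  \<open>c = 1\<close>.\<close>

lemma stab_proj_minimal: "minimal_projection N (cstar_gen N (W ` S)) (stab_proj S l)"
  unfolding minimal_projection_def
proof (intro conjI ballI impI stab_proj_projection stab_proj_nonzero)
  have alg: "star_algebra N (cstar_gen N (W ` S))" by (rule star_algebra_cstar_gen) auto
  have "cnj (l x) \<cdot>\<^sub>m W x \<in> cstar_gen N (W ` S)" if "x \<in> S" for x
    using that cstar_gen_superset[of "W ` S" N] star_algebraD(4)[OF alg] by blast
  then show "stab_proj S l \<in> cstar_gen N (W ` S)"
    unfolding stab_proj_def using S_finite S_ne by (intro mavg_in_star_algebra[OF alg]) auto
next
  fix Q assume Q: "Q \<in> cstar_gen N (W ` S)" and "projection Q \<and> Q * stab_proj S l = Q"
  then have Qp: "Q * Q = Q" "Q * stab_proj S l = Q" by (auto simp: projection_def)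
  obtain c where c: "Q = c \<cdot>\<^sub>m stab_proj S l" using cstar_gen_stab_proj[OF Q] Qp by auto
  have "(c * c) \<cdot>\<^sub>m stab_proj S l = Q * Q"
    unfolding c using stab_proj_projection by (simp add: sm projection_def)
  then have "(c * c) \<cdot>\<^sub>m stab_proj S l = c \<cdot>\<^sub>m stab_proj S l" using Qp c by simp
  then have "c * c = c" using smult_mat_cancel[OF stab_proj_carrier stab_proj_nonzero] by blast
  then have "c = 0 \<or> c = 1" by auto
  moreover have "0 \<cdot>\<^sub>m stab_proj S l = 0\<^sub>m N N" by (intro eq_matI) (auto simp: stab_proj_def mavg_def)
  ultimately show "Q = 0\<^sub>m N N \<or> Q = stab_proj S l" using c by auto
qed

end

text \<open>\<open>P\<close> commutes with each \<open>W x\<close>, so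
  \<open>minimal_projection_eigen\<close> yields phases; \<open>P\<close> itself then certifies
  them, and minimality of the resulting stabilizer projection identifies the two.\<close>

lemma minimal_projection_is_stab_proj:
  assumes S: "abelian S" and P: "minimal_projection N (cstar_gen N (W ` S)) P"
  shows "\<exists>l. (\<forall>x \<in> S. W x * P = l x \<cdot>\<^sub>m P) \<and> P = stab_proj S l"
proof -
  have alg: "star_algebra N (cstar_gen N (W ` S))" by (rule star_algebra_cstar_gen) auto
  have P': "P \<in> cstar_gen N (W ` S)" "P * P = P" "P \<noteq> 0\<^sub>m N N" "mat_adjoint P = P"
    using P by (auto simp: minimal_projection_def projection_def)
  have Pc: "P \<in> carrier_mat N N" using P'(1) star_algebraD(1)[OF alg] by auto
  have WS: "W x \<in> cstar_gen N (W ` S)" if "x \<in> S" for x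
    using that cstar_gen_superset[of "W ` S" N] by blast
  have "\<exists>l. W x * P = l \<cdot>\<^sub>m P" if x: "x \<in> S" for x
  proof -
    have xV: "x \<in> V" using x S by (auto simp: abelian_def)
    \<comment> \<open>The commutant of \<open>W x\<close> together with its adjoint; including the
      adjoint makes it a star algebra.\<close>
    define A where "A = {X \<in> carrier_mat N N. W x * X = X * W x \<and> mat_adjoint (W x) * X = X * mat_adjoint (W x)}"
    have "star_algebra N A"
    proof (rule star_algebraI)
      fix X Y assume XY: "X \<in> A" "Y \<in> A"
      then show "X + Y \<in> A"
        by (auto simp: A_def add_mult_distrib_mat[of _ N N _ _ N] mult_add_distrib_mat[of _ N N _ N])
      have c: "B * (X * Y) = X * Y * B"
        if "B * X = X * B" "B * Y = Y * B" "B \<in> carrier_mat N N" for B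
      proof -
        have X: "X \<in> carrier_mat N N" and Y: "Y \<in> carrier_mat N N" using XY by (auto simp: A_def)
        have "B * (X * Y) = (X * B) * Y" unfolding that(1)[symmetric] using X Y that(3) by (simp add: assoc)
        also have "\<dots> = X * (Y * B)" unfolding that(2)[symmetric] using X Y that(3) by (simp add: assoc)
        also have "\<dots> = X * Y * B" using X Y that(3) by (simp add: assoc)
        finally show ?thesis .
      qed
      show "X * Y \<in> A" using XY c[of "W x"] c[of "mat_adjoint (W x)"] by (auto simp: A_def mc)
    next
      fix c X assume "X \<in> A"
      then show "c \<cdot>\<^sub>m X \<in> A" by (auto simp: A_def sm)
    next
      fix X assume "X \<in> A"
      then have X: "X \<in> carrier_mat N N" "W x * X = X * W x" "mat_adjoint (W x) * X = X * mat_adjoint (W x)"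
        by (auto simp: A_def)
      have "mat_adjoint (W x) * mat_adjoint X = mat_adjoint (X * W x)"
        using X(1) by (simp add: mat_adjoint_mult[of _ N N _ N])
      also have "\<dots> = mat_adjoint X * mat_adjoint (W x)"
        unfolding X(2)[symmetric] using X(1) by (simp add: mat_adjoint_mult[of _ N N _ N])
      finally have 1: "mat_adjoint (W x) * mat_adjoint X = mat_adjoint X * mat_adjoint (W x)" .
      have "W x * mat_adjoint X = mat_adjoint (X * mat_adjoint (W x))"
        using X(1) by (simp add: mat_adjoint_mult[of _ N N _ N])
      also have "\<dots> = mat_adjoint X * W x"
        unfolding X(3)[symmetric] using X(1) by (simp add: mat_adjoint_mult[of _ N N _ N])
      finally show "mat_adjoint X \<in> A" using 1 X(1) by (simp add: A_def)
    qed (auto simp: A_def)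
    moreover have "W ` S \<subseteq> A"
    proof
      fix X assume "X \<in> W ` S"
      then obtain y where y: "y \<in> S" "X = W y" by blast
      have xy: "W x * W y = W y * W x" using S x y by (auto simp: abelian_def)
      \<comment> \<open>The adjoint is the inverse of \<open>W x\<close>, and inverses of commuting
        matrices commute as well.\<close>
      have "mat_adjoint (W x) * W y = mat_adjoint (W x) * (W y * W x) * mat_adjoint (W x)"
        using W_unitary'[OF xV] by (simp add: assoc mc one)
      also have "\<dots> = W y * mat_adjoint (W x)"
        using W_cancel[OF xV] by (simp add: xy[symmetric])
      finally show "X \<in> A" using xy y by (simp add: A_def)
    qed
    ultimately have "cstar_gen N (W ` S) \<subseteq> A" by (rule cstar_gen_least)
    then have "W x * P = P * W x" using P'(1) by (auto simp: A_def)
    moreover have "1\<^sub>m N \<in> cstar_gen N (W ` S)" using WS[of zero] S W_zero by (simp add: abelian_def)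
    moreover obtain c where "W x ^\<^sub>m d = c \<cdot>\<^sub>m 1\<^sub>m N" "cmod c = 1" using W_pow[OF xV] by blast
    ultimately show ?thesis
      using minimal_projection_eigen[OF d_pos W_carrier W_unitary[OF xV] _ _ alg WS[OF x] _ P] by blast
  qed
  then obtain l where l: "\<And>x. x \<in> S \<Longrightarrow> W x * P = l x \<cdot>\<^sub>m P" by metis
  let ?E = "stab_proj S l"
  note ctx = S Pc P'(3) l
  have EP: "?E * P = P" by (rule stab_proj_fix[OF ctx Pc l])
  obtain c where c: "?E * P = c \<cdot>\<^sub>m ?E" using cstar_gen_stab_proj[OF ctx P'(1)] by blast
  \<comment> \<open>The adjoint of \<open>E P = P\<close> is \<open>P E = P\<close>, which places
    \<open>P\<close> below the minimal projection \<open>E\<close>.\<close>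
  have "P = 0\<^sub>m N N \<or> P = ?E"
    using stab_proj_minimal[OF ctx] P' P EP c
    unfolding minimal_projection_def
    using arg_cong[OF EP, of mat_adjoint] stab_proj_adjoint[OF ctx] Pc stab_proj_carrier[OF ctx]
    by (metis mat_adjoint_mult)
  then show ?thesis using l P'(3) by blast
qed

section \<open>The stabilizer of a state and its projection\<close>

context
  fixes \<rho> :: "complex mat"
  assumes dens: "density N \<rho>"
begin

text \<open>The trace is against \<open>W x\<close> itself, whereas \<open>charfun\<close> uses the
  negated label; \<open>mean_state_eqI\<close> reconciles the two signs.\<close>

definition stabilizer :: "'x set" where
  "stabilizer = {x \<in> V. cmod (tr (\<rho> * W x)) = 1}"

private lemma \<rho>: "\<rho> \<in> carrier_mat N N" "mat_adjoint \<rho> = \<rho>" "tr \<rho> = 1"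
  using dens psd_carrier psd_adjoint by (auto simp: density_def)

private lemma \<rho>_nz: "\<rho> \<noteq> 0\<^sub>m N N"
  using \<rho>(3) by (auto simp: tr_def)

text \<open>Writing \<open>\<rho> = B B\<^sup>*\<close>, the matrix \<open>(W x - \<xi>) B\<close> has Hilbert-Schmidt norm zero.\<close>
lemma stabilizer_eigen:
  assumes "x \<in> stabilizer"
  shows "W x * \<rho> = tr (\<rho> * W x) \<cdot>\<^sub>m \<rho>"
proof -
  define \<xi> where "\<xi> = tr (\<rho> * W x)"
  have x: "x \<in> V" and xi: "\<xi> * cnj \<xi> = 1"
    using assms complex_norm_square[of \<xi>] by (auto simp: stabilizer_def \<xi>_def)
  obtain B where B: "B \<in> carrier_mat N N" "\<rho> = B * mat_adjoint B"
    using psd_factor[of N \<rho>] dens by (auto simp: density_def)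
  define C where "C = W x - \<xi> \<cdot>\<^sub>m 1\<^sub>m N"
  have C: "C \<in> carrier_mat N N" by (simp add: C_def minus_carrier_mat[of _ N N])
  have adjC: "mat_adjoint C = mat_adjoint (W x) - cnj \<xi> \<cdot>\<^sub>m 1\<^sub>m N"
    by (simp add: C_def mat_adjoint_minus[of _ N N])
  have C\<rho>: "C * \<rho> = W x * \<rho> - \<xi> \<cdot>\<^sub>m \<rho>"
    using \<rho> by (simp add: C_def minus_mult_distrib_mat[of _ N N _ _ N] sm one)
  have t1: "tr (W x * \<rho>) = \<xi>" unfolding \<xi>_def using \<rho> by (intro tr_mult_commute[of _ N N]) auto
  have "mat_adjoint (W x * \<rho>) = \<rho> * mat_adjoint (W x)"
    using \<rho> by (simp add: mat_adjoint_mult[of _ N N _ N])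
  then have t2: "tr (\<rho> * mat_adjoint (W x)) = cnj \<xi>"
    using t1 tr_mat_adjoint[of "W x * \<rho>" N] \<rho> by (simp add: mc)
  have t3: "tr (W x * \<rho> * mat_adjoint (W x)) = 1"
    using tr_mult_commute[of "W x * \<rho>" N N "mat_adjoint (W x)"] \<rho> W_cancel[OF x \<rho>(1)] by (simp add: mc)
  have "C * B * mat_adjoint (C * B) = C * \<rho> * mat_adjoint C"
    using B C by (simp add: mat_adjoint_mult[of _ N N _ N] assoc mc)
  also have "\<dots> = W x * \<rho> * mat_adjoint (W x) - \<xi> \<cdot>\<^sub>m (\<rho> * mat_adjoint (W x))
      - cnj \<xi> \<cdot>\<^sub>m (W x * \<rho> - \<xi> \<cdot>\<^sub>m \<rho>)"
    unfolding adjC C\<rho> using \<rho>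
    by (simp add: minus_mult_distrib_mat[of _ N N _ _ N] mult_minus_distrib_mat[of _ N N _ N] sm one mc
        minus_carrier_mat[of _ N N])
  \<comment> \<open>Unitarity gives the 1, the first cross term gives the squared modulus of
    \<open>\<xi>\<close>, and the last bracket vanishes because \<rho> has trace 1.\<close>
  finally have "tr (C * B * mat_adjoint (C * B)) = 1 - \<xi> * cnj \<xi> - cnj \<xi> * (\<xi> - \<xi>)"
    using \<rho> t1 t2 t3 by (simp add: tr_minus[of _ N] tr_smult[of _ N] mc minus_carrier_mat[of _ N N])
  then have "tr (C * B * mat_adjoint (C * B)) = 0" using xi by simp
  then have "C * B = 0\<^sub>m N N" using B C by (intro tr_self_adjoint_eq_0) (auto simp: mc)
  then have "C * \<rho> = 0\<^sub>m N N" using B C by (simp flip: assoc)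
  then have z: "W x * \<rho> - \<xi> \<cdot>\<^sub>m \<rho> = 0\<^sub>m N N" using C\<rho> by simp
  have "W x * \<rho> = \<xi> \<cdot>\<^sub>m \<rho>"
  proof (rule eq_matI)
    fix i j assume "i < dim_row (\<xi> \<cdot>\<^sub>m \<rho>)" "j < dim_col (\<xi> \<cdot>\<^sub>m \<rho>)"
    then show "(W x * \<rho>) $$ (i, j) = (\<xi> \<cdot>\<^sub>m \<rho>) $$ (i, j)"
      using arg_cong[OF z, of "\<lambda>M. M $$ (i, j)"] \<rho>(1) carrier_matD[OF W_carrier[of x]]
      by (simp del: index_mult_mat(1))
  qed (use \<rho> carrier_matD[OF W_carrier[of x]] in auto)
  then show ?thesis by (simp add: \<xi>_def)
qed

text \<open>Unit trace identifies the eigenvalue with the expectation value, and unitarity makes it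
  a phase.\<close>

lemma eigen_stabilizer:
  assumes "x \<in> V" "W x * \<rho> = l \<cdot>\<^sub>m \<rho>"
  shows "x \<in> stabilizer" "tr (\<rho> * W x) = l"
proof -
  have "tr (\<rho> * W x) = tr (W x * \<rho>)" using \<rho> by (intro tr_mult_commute[of _ N N]) auto
  then show t: "tr (\<rho> * W x) = l" using assms \<rho> by (simp add: tr_smult[of _ N])
  show "x \<in> stabilizer" using eigen_cmod[OF assms(1) \<rho>(1) \<rho>_nz assms(2)] t assms(1) by (simp add: stabilizer_def)
qed

text \<open>Both products \<open>W x W y\<close> and \<open>W y W x\<close> multiply \<rho> by the
  same number, and both are phases times one operator \<open>W (add x y)\<close>. As that operator
  does not annihilate \<rho>, the phases agree and the operators commute.\<close>

lemma abelian_stabilizer: "abelian stabilizer"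
  unfolding abelian_def
proof (intro conjI ballI)
  show "stabilizer \<subseteq> V" by (auto simp: stabilizer_def)
  show "zero \<in> stabilizer" using \<rho> by (intro eigen_stabilizer(1)[where l = 1]) (auto simp: zero_V W_zero one)
  fix x y assume xy: "x \<in> stabilizer" "y \<in> stabilizer"
  then have V: "x \<in> V" "y \<in> V" by (auto simp: stabilizer_def)
  define a b where "a = tr (\<rho> * W x)" and "b = tr (\<rho> * W y)"
  have e: "W x * \<rho> = a \<cdot>\<^sub>m \<rho>" "W y * \<rho> = b \<cdot>\<^sub>m \<rho>" using stabilizer_eigen xy by (auto simp: a_def b_def)
  have e2: "W x * W y * \<rho> = (a * b) \<cdot>\<^sub>m \<rho>" "W y * W x * \<rho> = (a * b) \<cdot>\<^sub>m \<rho>"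
    using e \<rho> by (simp_all add: assoc sm mult.commute)
  obtain c where c: "cmod c = 1" "W x * W y = c \<cdot>\<^sub>m W (add x y)" using W_mult V by meson
  obtain c' where c': "cmod c' = 1" "W y * W x = c' \<cdot>\<^sub>m W (add x y)" using W_mult V add_commute by metis
  define K where "K = W (add x y) * \<rho>"
  have K: "c \<cdot>\<^sub>m K = (a * b) \<cdot>\<^sub>m \<rho>" "c' \<cdot>\<^sub>m K = (a * b) \<cdot>\<^sub>m \<rho>"
    using e2 c c' \<rho> by (simp_all add: K_def sm)
  have "c * cnj c = 1" using c complex_norm_square[of c] by simp
  then have K1: "K = (cnj c * (a * b)) \<cdot>\<^sub>m \<rho>"
    using arg_cong[OF K(1), of "\<lambda>M. cnj c \<cdot>\<^sub>m M"] by (simp add: smult_smult_mat mult.commute)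
  then show "add x y \<in> stabilizer"
    unfolding K_def by (intro eigen_stabilizer(1)) (auto intro: add_V V)
  have "K \<noteq> 0\<^sub>m N N"
  proof
    assume "K = 0\<^sub>m N N"
    then have "mat_adjoint (W (add x y)) * K = 0\<^sub>m N N"
      using right_mult_zero_mat[of "mat_adjoint (W (add x y))" N N] by simp
    then show False using W_cancel[of "add x y" \<rho>] V add_V \<rho> \<rho>_nz by (simp add: K_def)
  qed
  then have "c = c'" using K smult_mat_cancel[of K N c c'] \<rho> by (simp add: K_def mc)
  then show "W x * W y = W y * W x" using c c' by simp
qed

definition mean_proj :: "complex mat" where
  "mean_proj = stab_proj stabilizer (\<lambda>x. tr (\<rho> * W x))"

private lemmas ctx = abelian_stabilizer \<rho>(1) \<rho>_nz stabilizer_eigen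

lemma mean_proj:
  shows "mean_proj \<in> carrier_mat N N" "projection mean_proj"
    "minimal_projection N (cstar_gen N (W ` stabilizer)) mean_proj"
    "real (mat_rank N mean_proj) = real N / real (card stabilizer)"
    "tr mean_proj = of_nat (mat_rank N mean_proj)"
    "mean_proj * \<rho> = \<rho>"
  unfolding mean_proj_def
  using stab_proj_carrier[OF ctx] stab_proj_projection[OF ctx] stab_proj_minimal[OF ctx]
    rank_stab_proj[OF ctx] stab_proj_fix[OF ctx \<rho>(1) stabilizer_eigen]
    rank_projection[OF stab_proj_carrier[OF ctx] stab_proj_projection[OF ctx]]
  by auto

text \<open>Dividing by the rank leaves precisely the truncated values that define the mean
  state.\<close>

lemma tr_mean_proj_W:
  assumes "y \<in> V"
  shows "tr (mean_proj * W y) = (if cmod (tr (\<rho> * W y)) = 1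
    then of_nat (mat_rank N mean_proj) * tr (\<rho> * W y) else 0)"
proof -
  have "complex_of_nat (mat_rank N mean_proj) = of_real (real N / real (card stabilizer))"
    using mean_proj(4) by (metis of_real_of_nat_eq)
  then show ?thesis
    using tr_stab_proj_W[OF ctx assms] assms unfolding mean_proj_def by (simp add: stabilizer_def)
qed

lemma card_stabilizer_pos: "card stabilizer > 0"
  using abelian_stabilizer finite_V finite_subset by (auto simp: abelian_def card_gt_0_iff)

lemma mean_proj_rank_pos: "mat_rank N mean_proj > 0"
proof -
  have "real (mat_rank N mean_proj) > 0" using mean_proj(4) N_pos card_stabilizer_pos by simp
  then show ?thesis by simp
qed

lemma mean_proj_least:
  assumes S: "abelian S" and P: "minimal_projection N (cstar_gen N (W ` S)) P" and P\<rho>: "P * \<rho> = \<rho>"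
  shows "P = mean_proj \<or> mat_rank N P > mat_rank N mean_proj"
proof -
  obtain l where l: "\<And>x. x \<in> S \<Longrightarrow> W x * P = l x \<cdot>\<^sub>m P" and PE: "P = stab_proj S l"
    using minimal_projection_is_stab_proj[OF S P] by blast
  have alg: "star_algebra N (cstar_gen N (W ` S))" by (rule star_algebra_cstar_gen) auto
  have Pc: "P \<in> carrier_mat N N" "P \<noteq> 0\<^sub>m N N"
    using P star_algebraD(1)[OF alg] by (auto simp: minimal_projection_def)
  have "W x * \<rho> = l x \<cdot>\<^sub>m \<rho>" if "x \<in> S" for x
  proof -
    have "W x * (P * \<rho>) = l x \<cdot>\<^sub>m (P * \<rho>)" using l[OF that] Pc \<rho> by (simp add: sm flip: assoc)
    then show ?thesis using P\<rho> by simp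
  qed
  then have in_stab: "x \<in> stabilizer" and l_eq: "tr (\<rho> * W x) = l x" if "x \<in> S" for x
    using that S eigen_stabilizer by (auto simp: abelian_def)
  have rank: "real (mat_rank N P) = real N / real (card S)"
    unfolding PE by (rule rank_stab_proj[OF S Pc l])
  have fin: "finite stabilizer" using finite_V by (simp add: stabilizer_def)
  \<comment> \<open>\<open>S\<close> is contained in the stabilizer. Equality forces the same
    average, because the phases are read off \<rho>; proper inclusion makes
    \<open>N / card S\<close> strictly larger.\<close>
  show ?thesis
  proof (cases "S = stabilizer")
    case True
    have "P = mean_proj"
      unfolding PE mean_proj_def stab_proj_def mavg_def True[symmetric] using l_eq by (simp cong: msum_cong)
    then show ?thesis by simp
  next
    case False
    then have "card S < card stabilizer" using in_stab fin by (intro psubset_card_mono) auto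
    moreover have "card S > 0" using S fin in_stab finite_subset[of S stabilizer]
      by (auto simp: abelian_def card_gt_0_iff)
    ultimately have "real (mat_rank N mean_proj) < real (mat_rank N P)"
      unfolding rank mean_proj(4) using N_pos by (intro divide_strict_left_mono) auto
    then show ?thesis by simp
  qed
qed

end

end

section \<open>The n-qudit Weyl operators\<close>

lemma digit_less: "d > 0 \<Longrightarrow> digit d r j < d"
  by (simp add: digit_def)

lemma digits_eq_imp_eq:
  assumes "d > 0" "r < d ^ n" "s < d ^ n" "\<And>j. j < n \<Longrightarrow> digit d r j = digit d s j"
  shows "r = s"
  using assms(2-)
proof (induction n arbitrary: r s)
  case 0
  then show ?case by simp
next
  case (Suc n)
  have shift: "digit d (m div d) j = digit d m (Suc j)" for m j
    by (simp add: digit_def div_mult2_eq)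
  have "r div d = s div d"
  proof (rule Suc.IH)
    show "r div d < d ^ n" "s div d < d ^ n"
      using Suc.prems by (auto simp: less_mult_imp_div_less mult.commute)
    show "digit d (r div d) j = digit d (s div d) j" if "j < n" for j
      using Suc.prems(3)[of "Suc j"] that by (simp add: shift)
  qed
  moreover have "r mod d = s mod d" using Suc.prems(3)[of 0] by (simp add: digit_def)
  ultimately show ?case by (metis div_mult_mod_eq)
qed

lemma digits_eq_iff:
  assumes "d > 0" "r < d ^ n" "s < d ^ n"
  shows "(\<forall>j<n. digit d r j = digit d s j) \<longleftrightarrow> r = s"
  using digits_eq_imp_eq[OF assms] by auto

text \<open>Digit expansion is a bijection onto tuples, onto by counting, so the sum distributes.
  Since Weyl entries are products over digits, this reduces the n-qudit identities to single-qudit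
  ones.\<close>

lemma sum_prod_digits:
  fixes f :: "nat \<Rightarrow> nat \<Rightarrow> complex"
  assumes d: "d > 0"
  shows "(\<Sum>r<d ^ n. \<Prod>j<n. f j (digit d r j)) = (\<Prod>j<n. \<Sum>a<d. f j a)"
proof -
  let ?P = "PiE {..<n} (\<lambda>_. {..<d})" and ?h = "\<lambda>r. restrict (digit d r) {..<n}"
  have inj: "inj_on ?h {..<d ^ n}"
  proof (rule inj_onI)
    fix r s assume rs: "r \<in> {..<d ^ n}" "s \<in> {..<d ^ n}" "?h r = ?h s"
    have "digit d r j = digit d s j" if "j < n" for j
      using fun_cong[OF rs(3), of j] that by simp
    then show "r = s" using rs(1,2) digits_eq_imp_eq[OF d, of r n s] by simp
  qed
  have "?h ` {..<d ^ n} = ?P"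
  proof (rule card_subset_eq)
    show "?h ` {..<d ^ n} \<subseteq> ?P" using d by (intro image_subsetI) (simp add: restrict_PiE_iff digit_less)
    show "card (?h ` {..<d ^ n}) = card ?P" using inj by (simp add: card_image card_PiE)
  qed (simp add: finite_PiE)
  then have bij: "bij_betw ?h {..<d ^ n} ?P" using inj by (simp add: bij_betw_def)
  have "(\<Prod>j<n. \<Sum>a<d. f j a) = (\<Sum>g\<in>?P. \<Prod>j<n. f j (g j))"
    by (rule prod_sum_PiE) auto
  also have "\<dots> = (\<Sum>r<d ^ n. \<Prod>j<n. f j (?h r j))"
    by (rule sum.reindex_bij_betw[OF bij, symmetric])
  also have "\<dots> = (\<Sum>r<d ^ n. \<Prod>j<n. f j (digit d r j))" by simp
  finally show ?thesis by simp
qed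

lemma prod_of_bool:
  assumes "finite A"
  shows "(\<Prod>x\<in>A. if P x then c else 0) = (if \<forall>x\<in>A. P x then c ^ card A else (0 :: complex))"
  using assms by (auto intro!: prod_zero)

text \<open>\<open>Vn\<close> pads its functions with 0 beyond \<open>n\<close>, \<open>PiE\<close>
  with \<open>undefined\<close>; the map translates between the two conventions.\<close>

lemma Vn_bij:
  "bij_betw (\<lambda>h. ((\<lambda>j. if j < n then fst (h j) else 0), (\<lambda>j. if j < n then snd (h j) else 0)))
     (PiE {..<n} (\<lambda>_. {..<d} \<times> {..<d})) (Vn d n)"
proof (rule bij_betw_byWitness[where f' = "\<lambda>x. restrict (\<lambda>j. (fst x j, snd x j)) {..<n}"], goal_cases)
  case 1
  show ?case
  proof (intro ballI ext)
    fix h j assume "h \<in> PiE {..<n} (\<lambda>_. {..<d} \<times> {..<d})"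
    then show "restrict (\<lambda>j. (fst ((\<lambda>j. if j < n then fst (h j) else 0), (\<lambda>j. if j < n then snd (h j) else 0)) j,
        snd ((\<lambda>j. if j < n then fst (h j) else 0), (\<lambda>j. if j < n then snd (h j) else 0)) j)) {..<n} j = h j"
      using PiE_arb[of h _ _ j] by (cases "j < n") auto
  qed
next
  case 2
  then show ?case by (auto simp: Vn_def prod_eq_iff fun_eq_iff not_less)
next
  case 3
  show ?case
  proof (rule image_subsetI)
    fix h assume h: "h \<in> PiE {..<n} (\<lambda>_. {..<d} \<times> {..<d})"
    have "fst (h j) < d \<and> snd (h j) < d" if "j < n" for j
      using PiE_mem[OF h, of j] that by (auto simp: mem_Times_iff)
    then show "((\<lambda>j. if j < n then fst (h j) else 0), (\<lambda>j. if j < n then snd (h j) else 0)) \<in> Vn d n"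
      by (simp add: Vn_def)
  qed
next
  case 4
  show ?case by (intro image_subsetI) (auto simp: Vn_def restrict_PiE_iff simp del: PiE_restrict)
qed

lemma sum_prod_Vn:
  fixes g :: "nat \<Rightarrow> nat \<Rightarrow> nat \<Rightarrow> complex"
  shows "(\<Sum>x\<in>Vn d n. \<Prod>j<n. g j (fst x j) (snd x j)) = (\<Prod>j<n. \<Sum>p<d. \<Sum>q<d. g j p q)"
proof -
  have "(\<Sum>x\<in>Vn d n. \<Prod>j<n. g j (fst x j) (snd x j))
      = (\<Sum>h\<in>PiE {..<n} (\<lambda>_. {..<d} \<times> {..<d}). \<Prod>j<n. g j (fst (h j)) (snd (h j)))"
    by (subst sum.reindex_bij_betw[OF Vn_bij, symmetric]) simp
  also have "\<dots> = (\<Prod>j<n. \<Sum>y\<in>{..<d} \<times> {..<d}. g j (fst y) (snd y))"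
    by (rule prod_sum_PiE[symmetric]) auto
  finally show ?thesis by (simp add: sum.cartesian_product case_prod_unfold)
qed

lemma finite_Vn: "finite (Vn d n)"
  using bij_betw_finite[OF Vn_bij[of n d]] by (simp add: finite_PiE)

lemma chi_cong:
  assumes "d > 0" "int d dvd a - b"
  shows "chi d a = chi d b"
  using chi_add[of d "a - b" b] chi_eq_1_iff[OF assms(1), of "a - b"] assms(2) by simp

lemma chi_mult_cnj: "chi d a * cnj (chi d b) = chi d (a - b)"
  by (simp add: chi_eq_cis cis_cnj cis_mult diff_divide_distrib right_diff_distrib)

lemma cmod_wphase[simp]: "cmod (wphase d p q) = 1"
  by (simp add: wphase_def norm_power)

lemma wphase_cnj: "wphase d p q * cnj (wphase d p q) = 1"
  using complex_norm_square[of "wphase d p q"] by simp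

section \<open>Single-qudit Weyl operators\<close>

lemma w1_index:
  "a < d \<Longrightarrow> b < d \<Longrightarrow>
    w1 d p q $$ (a, b) = (if a = (b + q) mod d then wphase d p q * chi d (int (p * a)) else 0)"
  by (simp add: w1_def)

lemma mod_add_left_cancel_less:
  fixes x y z d :: nat
  assumes "(x + y) mod d = (x + z) mod d" "y < d" "z < d"
  shows "y = z"
proof -
  obtain a b where "x + y + d * a = x + z + d * b" using assms(1) unfolding nat_mod_eq_iff by blast
  then have "y + d * a = z + d * b" by simp
  then have "(y + d * a) mod d = (z + d * b) mod d" by simp
  then show ?thesis using assms(2,3) by simp
qed

lemma w1_mult:
  assumes d: "d > 0"
  shows "\<exists>c. cmod c = 1 \<and> (\<forall>a<d. \<forall>b<d. (\<Sum>k<d. w1 d p q $$ (a, k) * w1 d p' q' $$ (k, b))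
    = c * w1 d ((p + p') mod d) ((q + q') mod d) $$ (a, b))"
proof -
  let ?p = "(p + p') mod d" and ?q = "(q + q') mod d"
  \<comment> \<open>Moving \<open>X ^ q\<close> past \<open>Z ^ p'\<close> costs
    \<open>chi d (- p' q)\<close>; the other factors exchange the two old Weyl phases for the new
    one, whose inverse is its conjugate.\<close>
  define c where "c = wphase d p q * wphase d p' q' * cnj (wphase d ?p ?q) * chi d (- int (p' * q))"
  have "(\<Sum>k<d. w1 d p q $$ (a, k) * w1 d p' q' $$ (k, b)) = c * w1 d ?p ?q $$ (a, b)"
    if ab: "a < d" "b < d" for a b
  proof -
    define k where "k = (b + q') mod d"
    have k: "k < d" using d by (simp add: k_def)
    have "(\<Sum>i<d. w1 d p q $$ (a, i) * w1 d p' q' $$ (i, b))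
        = (\<Sum>i<d. if i = k then w1 d p q $$ (a, k) * w1 d p' q' $$ (k, b) else 0)"
      using ab by (intro sum.cong) (auto simp: w1_index k_def)
    also have "\<dots> = w1 d p q $$ (a, k) * w1 d p' q' $$ (k, b)" using k by simp
    finally have s: "(\<Sum>i<d. w1 d p q $$ (a, i) * w1 d p' q' $$ (i, b)) = \<dots>" .
    have e: "(k + q) mod d = (b + ?q) mod d" by (simp add: k_def mod_simps ac_simps)
    show ?thesis
    proof (cases "a = (k + q) mod d")
      case False
      then show ?thesis unfolding s using ab k e by (simp add: w1_index)
    next
      case True
      have 1: "int d dvd int a - int (k + q)"
        unfolding True by (simp add: zmod_int mod_eq_dvd_iff[symmetric])
      have 2: "int d dvd int ?p - int (p + p')"
        by (simp add: zmod_int mod_eq_dvd_iff[symmetric])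
      \<comment> \<open>The exponents differ by a multiple of \<open>d\<close>: one part from
        reducing \<open>p + p'\<close>, the other from \<open>a\<close> being \<open>k + q\<close>
        reduced.\<close>
      have 3: "int (p * a) + int (p' * k) - (- int (p' * q) + int (?p * a))
          = - (int ?p - int (p + p')) * int a - int p' * (int a - int (k + q))"
        by (simp add: algebra_simps)
      have "int d dvd int (p * a) + int (p' * k) - (- int (p' * q) + int (?p * a))"
        unfolding 3 by (intro dvd_diff dvd_mult2[OF iffD2[OF dvd_minus_iff 2]] dvd_mult[OF 1])
      then have 4: "chi d (int (p * a)) * chi d (int (p' * k)) = chi d (- int (p' * q)) * chi d (int (?p * a))"
        unfolding chi_add[symmetric] by (rule chi_cong[OF d])
      have "w1 d p q $$ (a, k) * w1 d p' q' $$ (k, b)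
          = wphase d p q * wphase d p' q' * (chi d (int (p * a)) * chi d (int (p' * k)))"
        using ab k True by (simp add: w1_index k_def)
      also have "\<dots> = c * w1 d ?p ?q $$ (a, b)"
        unfolding 4 using ab True e wphase_cnj[of d ?p ?q] by (simp add: w1_index c_def ac_simps)
      finally show ?thesis unfolding s .
    qed
  qed
  moreover have "cmod c = 1" by (simp add: c_def norm_mult)
  ultimately show ?thesis by blast
qed

lemma w1_unitary:
  assumes d: "d > 0" and ab: "a < d" "b < d"
  shows "(\<Sum>k<d. cnj (w1 d p q $$ (k, a)) * w1 d p q $$ (k, b)) = (if a = b then 1 else 0)"
proof -
  define k where "k = (b + q) mod d"
  have k: "k < d" using d by (simp add: k_def)
  have "(\<Sum>i<d. cnj (w1 d p q $$ (i, a)) * w1 d p q $$ (i, b))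
      = (\<Sum>i<d. if i = k then cnj (w1 d p q $$ (k, a)) * w1 d p q $$ (k, b) else 0)"
    using ab by (intro sum.cong) (auto simp: w1_index k_def)
  also have "\<dots> = cnj (w1 d p q $$ (k, a)) * w1 d p q $$ (k, b)" using k by simp
  also have "\<dots> = (if a = b then 1 else 0)"
  proof (cases "a = b")
    case True
    have "w1 d p q $$ (k, b) * cnj (w1 d p q $$ (k, b)) = 1"
      using complex_norm_square[of "w1 d p q $$ (k, b)"] ab k by (simp add: w1_index norm_mult k_def)
    then show ?thesis using True by (simp add: mult.commute)
  next
    case False
    then have "k \<noteq> (a + q) mod d"
      using mod_add_left_cancel_less[of q a d b] ab by (auto simp: k_def add.commute)
    then show ?thesis using False ab k by (simp add: w1_index)
  qed
  finally show ?thesis .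
qed

text \<open>A nonzero shift has no diagonal entries; without a shift the diagonal is a nontrivial
  character sum.\<close>

lemma w1_trace:
  assumes "p < d" "q < d" "p \<noteq> 0 \<or> q \<noteq> 0"
  shows "(\<Sum>a<d. w1 d p q $$ (a, a)) = 0"
proof (cases "q = 0")
  case False
  have "a \<noteq> (a + q) mod d" if "a < d" for a
    using mod_add_left_cancel_less[of a 0 d q] that assms False by auto
  then show ?thesis by (simp add: w1_index)
next
  case True
  have "(\<Sum>a<d. w1 d p q $$ (a, a)) = (\<Sum>a<d. wphase d p q * chi d (int a * int p))"
    using True by (intro sum.cong) (auto simp: w1_index mult.commute)
  also have "\<dots> = wphase d p q * (if int d dvd int p then of_nat d else 0)"
    using sum_chi[of d "int p"] assms by (simp add: sum_distrib_left[symmetric])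
  finally show ?thesis using True assms by (auto dest: dvd_imp_le)
qed

text \<open>The Weyl phases cancel against their conjugates. The sum over \<open>p\<close> forces
  \<open>a = a'\<close>, and a common shift \<open>q\<close> then forces
  \<open>b = b'\<close>.\<close>

lemma w1_complete:
  assumes d: "d > 0" and a: "a < d" "a' < d" and b: "b < d" "b' < d"
  shows "(\<Sum>p<d. \<Sum>q<d. w1 d p q $$ (a, b) * cnj (w1 d p q $$ (a', b')))
    = (if a = a' \<and> b = b' then of_nat d else 0)"
proof -
  have t: "w1 d p q $$ (a, b) * cnj (w1 d p q $$ (a', b'))
      = (if a = (b + q) mod d \<and> a' = (b' + q) mod d then chi d (int p * (int a - int a')) else 0)" for p q
  proof -
    have "wphase d p q * chi d (int (p * a)) * cnj (wphase d p q * chi d (int (p * a')))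
        = (wphase d p q * cnj (wphase d p q)) * (chi d (int (p * a)) * cnj (chi d (int (p * a'))))"
      by (simp add: ac_simps)
    also have "\<dots> = chi d (int p * (int a - int a'))"
      unfolding wphase_cnj chi_mult_cnj by (simp add: right_diff_distrib)
    finally have e: "wphase d p q * chi d (int (p * a)) * cnj (wphase d p q * chi d (int (p * a')))
        = chi d (int p * (int a - int a'))" .
    show ?thesis
    proof (cases "a = (b + q) mod d \<and> a' = (b' + q) mod d")
      case True
      note T = conjunct1[OF True] conjunct2[OF True]
      show ?thesis
        unfolding w1_index[OF a(1) b(1)] w1_index[OF a(2) b(2)] if_P[OF T(1)] if_P[OF T(2)] if_P[OF True]
        by (rule e)
    qed (use a b in \<open>auto simp: w1_index\<close>)
  qed
  have "(\<Sum>p<d. \<Sum>q<d. w1 d p q $$ (a, b) * cnj (w1 d p q $$ (a', b')))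
      = (\<Sum>q<d. if a = (b + q) mod d \<and> a' = (b' + q) mod d
          then (\<Sum>p<d. chi d (int p * (int a - int a'))) else 0)"
    unfolding t by (subst sum.swap) (auto intro!: sum.cong)
  also have "(\<Sum>p<d. chi d (int p * (int a - int a'))) = (if a = a' then of_nat d else 0)"
  proof -
    have "int d dvd int a - int a' \<longleftrightarrow> a = a'"
      using a by (metis mod_eq_dvd_iff mod_less of_nat_eq_iff zmod_int)
    then show ?thesis by (simp add: sum_chi[OF d])
  qed
  finally have s: "(\<Sum>p<d. \<Sum>q<d. w1 d p q $$ (a, b) * cnj (w1 d p q $$ (a', b')))
      = (\<Sum>q<d. if a = (b + q) mod d \<and> a' = (b' + q) mod d then (if a = a' then of_nat d else 0) else 0)" .
  show ?thesis
  proof (cases "a = a' \<and> b = b'")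
    case True
    \<comment> \<open>The only shift taking \<open>b\<close> to \<open>a\<close>, namely
      \<open>a - b\<close> modulo \<open>d\<close>.\<close>
    define q0 where "q0 = (a + (d - b)) mod d"
    have q0: "q0 < d" "(b + q0) mod d = a"
      using d a b by (auto simp: q0_def mod_simps)
    have "a = (b + q) mod d \<longleftrightarrow> q = q0" if "q < d" for q
      using mod_add_left_cancel_less[of b q d q0, OF _ that q0(1)] q0(2) by metis
    then have "(\<Sum>q<d. if a = (b + q) mod d then of_nat d else 0 :: complex) = (\<Sum>q<d. if q = q0 then of_nat d else 0)"
      by (intro sum.cong) auto
    then show ?thesis unfolding s using True q0 by simp
  next
    case False
    have "\<not> (a = (b + q) mod d \<and> a = (b' + q) mod d)" if "b \<noteq> b'" for q
      using mod_add_left_cancel_less[of q b d b'] b that by (auto simp: add.commute)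
    then show ?thesis unfolding s using False by (auto intro!: sum.neutral)
  qed
qed

section \<open>Tensor products of Weyl operators\<close>

lemma Weyl_carrier[simp]: "Weyl d n x \<in> carrier_mat (d ^ n) (d ^ n)"
  by (simp add: Weyl_def weyl_def)

lemma dim_Weyl[simp]: "dim_row (Weyl d n x) = d ^ n" "dim_col (Weyl d n x) = d ^ n"
  using carrier_matD[OF Weyl_carrier] by auto

lemma Weyl_index:
  "r < d ^ n \<Longrightarrow> c < d ^ n \<Longrightarrow>
    Weyl d n x $$ (r, c) = (\<Prod>j<n. w1 d (fst x j) (snd x j) $$ (digit d r j, digit d c j))"
  by (simp add: Weyl_def weyl_def)

lemma Weyl_mult:
  assumes d: "d > 0"
  shows "\<exists>c. cmod c = 1 \<and> Weyl d n x * Weyl d n y = c \<cdot>\<^sub>m Weyl d n (vadd d x y)"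
proof -
  define F where "F j c \<longleftrightarrow> cmod c = 1 \<and> (\<forall>a<d. \<forall>b<d.
      (\<Sum>k<d. w1 d (fst x j) (snd x j) $$ (a, k) * w1 d (fst y j) (snd y j) $$ (k, b))
      = c * w1 d (fst (vadd d x y) j) (snd (vadd d x y) j) $$ (a, b))" for j c
  have "\<forall>j. \<exists>c. F j c" unfolding F_def using w1_mult[OF d] by (simp add: vadd_def)
  then obtain c where F: "\<And>j. F j (c j)" by metis
  have c: "cmod (c j) = 1" for j using F by (simp add: F_def)
  have m: "(\<Sum>k<d. w1 d (fst x j) (snd x j) $$ (a, k) * w1 d (fst y j) (snd y j) $$ (k, b))
      = c j * w1 d (fst (vadd d x y) j) (snd (vadd d x y) j) $$ (a, b)" if "a < d" "b < d" for j a b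
    using F[of j] that by (simp add: F_def)
  have "Weyl d n x * Weyl d n y = (\<Prod>j<n. c j) \<cdot>\<^sub>m Weyl d n (vadd d x y)"
  proof (rule eq_matI)
    fix r s assume "r < dim_row ((\<Prod>j<n. c j) \<cdot>\<^sub>m Weyl d n (vadd d x y))"
      "s < dim_col ((\<Prod>j<n. c j) \<cdot>\<^sub>m Weyl d n (vadd d x y))"
    then have rs: "r < d ^ n" "s < d ^ n" by auto
    have "(Weyl d n x * Weyl d n y) $$ (r, s) = (\<Sum>k<d ^ n. Weyl d n x $$ (r, k) * Weyl d n y $$ (k, s))"
      using rs by (subst mult_mat_index) auto
    also have "\<dots> = (\<Sum>k<d ^ n. \<Prod>j<n. w1 d (fst x j) (snd x j) $$ (digit d r j, digit d k j)
        * w1 d (fst y j) (snd y j) $$ (digit d k j, digit d s j))"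
      using rs by (intro sum.cong refl) (simp add: Weyl_index prod.distrib)
    also have "\<dots> = (\<Prod>j<n. \<Sum>k<d. w1 d (fst x j) (snd x j) $$ (digit d r j, k)
        * w1 d (fst y j) (snd y j) $$ (k, digit d s j))"
      by (rule sum_prod_digits[OF d])
    also have "\<dots> = (\<Prod>j<n. c j) * Weyl d n (vadd d x y) $$ (r, s)"
      using rs d by (simp add: m digit_less Weyl_index prod.distrib)
    finally show "(Weyl d n x * Weyl d n y) $$ (r, s) = ((\<Prod>j<n. c j) \<cdot>\<^sub>m Weyl d n (vadd d x y)) $$ (r, s)"
      using rs by simp
  qed auto
  moreover have "cmod (\<Prod>j<n. c j) = 1" by (simp add: c flip: prod_norm)
  ultimately show ?thesis by blast
qed

lemma Weyl_unitary:
  assumes d: "d > 0"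
  shows "mat_adjoint (Weyl d n x) * Weyl d n x = 1\<^sub>m (d ^ n)"
proof (rule eq_matI)
  fix r s assume "r < dim_row (1\<^sub>m (d ^ n))" "s < dim_col (1\<^sub>m (d ^ n))"
  then have rs: "r < d ^ n" "s < d ^ n" by auto
  have "(mat_adjoint (Weyl d n x) * Weyl d n x) $$ (r, s)
      = (\<Sum>k<d ^ n. cnj (Weyl d n x $$ (k, r)) * Weyl d n x $$ (k, s))"
    using rs by (subst mult_mat_index) auto
  also have "\<dots> = (\<Sum>k<d ^ n. \<Prod>j<n. cnj (w1 d (fst x j) (snd x j) $$ (digit d k j, digit d r j))
      * w1 d (fst x j) (snd x j) $$ (digit d k j, digit d s j))"
    using rs by (intro sum.cong refl) (simp add: Weyl_index prod.distrib)
  also have "\<dots> = (\<Prod>j<n. \<Sum>k<d. cnj (w1 d (fst x j) (snd x j) $$ (k, digit d r j))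
      * w1 d (fst x j) (snd x j) $$ (k, digit d s j))"
    by (rule sum_prod_digits[OF d])
  also have "\<dots> = (\<Prod>j<n. if digit d r j = digit d s j then 1 else 0)"
    using d by (simp add: w1_unitary digit_less)
  also have "\<dots> = 1\<^sub>m (d ^ n) $$ (r, s)"
    using rs digits_eq_iff[OF d rs] by (auto simp: prod_of_bool)
  finally show "(mat_adjoint (Weyl d n x) * Weyl d n x) $$ (r, s) = 1\<^sub>m (d ^ n) $$ (r, s)" .
qed auto

lemma Weyl_zero:
  assumes d: "d > 0"
  shows "Weyl d n ((\<lambda>_. 0), (\<lambda>_. 0)) = 1\<^sub>m (d ^ n)"
proof (rule eq_matI)
  fix r s assume "r < dim_row (1\<^sub>m (d ^ n))" "s < dim_col (1\<^sub>m (d ^ n))"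
  then have rs: "r < d ^ n" "s < d ^ n" by auto
  have "w1 d 0 0 $$ (a, b) = (if a = b then 1 else 0)" if "a < d" "b < d" for a b
    using that by (simp add: w1_index wphase_def)
  then have "Weyl d n ((\<lambda>_. 0), (\<lambda>_. 0)) $$ (r, s) = (\<Prod>j<n. if digit d r j = digit d s j then 1 else 0)"
    using rs d by (simp add: Weyl_index digit_less)
  then show "Weyl d n ((\<lambda>_. 0), (\<lambda>_. 0)) $$ (r, s) = 1\<^sub>m (d ^ n) $$ (r, s)"
    using rs digits_eq_iff[OF d rs] by (auto simp: prod_of_bool)
qed auto

lemma tr_Weyl:
  assumes d: "d > 0" and x: "x \<in> Vn d n" "x \<noteq> ((\<lambda>_. 0), (\<lambda>_. 0))"
  shows "tr (Weyl d n x) = 0"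
proof -
  have "tr (Weyl d n x) = (\<Sum>r<d ^ n. \<Prod>j<n. w1 d (fst x j) (snd x j) $$ (digit d r j, digit d r j))"
    by (simp add: tr_def Weyl_index)
  also have "\<dots> = (\<Prod>j<n. \<Sum>a<d. w1 d (fst x j) (snd x j) $$ (a, a))"
    by (rule sum_prod_digits[OF d])
  also have "\<dots> = 0"
  proof -
    obtain j where j: "fst x j \<noteq> 0 \<or> snd x j \<noteq> 0"
      using x(2) by (auto simp: prod_eq_iff fun_eq_iff)
    then have "j < n" using x(1) by (intro not_le_imp_less) (auto simp: Vn_def)
    moreover from this have "fst x j < d" "snd x j < d" using x(1) by (auto simp: Vn_def)
    ultimately show ?thesis using w1_trace[of "fst x j" d "snd x j"] j by (intro prod_zero) auto
  qed
  finally show ?thesis .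
qed

text \<open>Weighting the vanishing traces with conjugated Weyl entries and summing isolates one
  entry of \<open>A\<close>, times \<open>d ^ n\<close>. Hence a matrix is determined by its
  characteristic function.\<close>

lemma Weyl_complete:
  assumes d: "d > 0" and A: "A \<in> carrier_mat (d ^ n) (d ^ n)"
    and z: "\<And>x. x \<in> Vn d n \<Longrightarrow> tr (A * Weyl d n x) = 0"
  shows "A = 0\<^sub>m (d ^ n) (d ^ n)"
proof (rule eq_matI)
  let ?N = "d ^ n"
  fix s r assume "s < dim_row (0\<^sub>m ?N ?N)" "r < dim_col (0\<^sub>m ?N ?N)"
  then have rs: "s < ?N" "r < ?N" by auto
  have orth: "(\<Sum>x\<in>Vn d n. Weyl d n x $$ (k, i) * cnj (Weyl d n x $$ (r, s)))
      = (if k = r \<and> i = s then of_nat d ^ n else 0)" if ik: "i < ?N" "k < ?N" for i k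
  proof -
    have "(\<Sum>x\<in>Vn d n. Weyl d n x $$ (k, i) * cnj (Weyl d n x $$ (r, s)))
        = (\<Sum>x\<in>Vn d n. \<Prod>j<n. w1 d (fst x j) (snd x j) $$ (digit d k j, digit d i j)
            * cnj (w1 d (fst x j) (snd x j) $$ (digit d r j, digit d s j)))"
      using ik rs by (simp add: Weyl_index prod.distrib)
    also have "\<dots> = (\<Prod>j<n. \<Sum>p<d. \<Sum>q<d. w1 d p q $$ (digit d k j, digit d i j)
            * cnj (w1 d p q $$ (digit d r j, digit d s j)))"
      by (rule sum_prod_Vn)
    also have "\<dots> = (\<Prod>j<n. if digit d k j = digit d r j \<and> digit d i j = digit d s j then of_nat d else 0)"
      using d by (simp add: w1_complete digit_less)
    also have "\<dots> = (if k = r \<and> i = s then of_nat d ^ n else 0)"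
      using digits_eq_iff[OF d ik(2) rs(2)] digits_eq_iff[OF d ik(1) rs(1)] by (auto simp: prod_of_bool)
    finally show ?thesis .
  qed
  have "0 = (\<Sum>x\<in>Vn d n. tr (A * Weyl d n x) * cnj (Weyl d n x $$ (r, s)))" by (simp add: z)
  also have "\<dots> = (\<Sum>x\<in>Vn d n. \<Sum>i<?N. \<Sum>k<?N. A $$ (i, k) * (Weyl d n x $$ (k, i) * cnj (Weyl d n x $$ (r, s))))"
    by (simp add: tr_mult[OF A] sum_distrib_right mult.assoc)
  also have "\<dots> = (\<Sum>i<?N. \<Sum>k<?N. A $$ (i, k) * (\<Sum>x\<in>Vn d n. Weyl d n x $$ (k, i) * cnj (Weyl d n x $$ (r, s))))"
    by (subst sum.swap, intro sum.cong refl, subst sum.swap) (simp add: sum_distrib_left)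
  also have "\<dots> = (\<Sum>i<?N. \<Sum>k<?N. if k = r then (if i = s then A $$ (s, r) * of_nat d ^ n else 0) else 0)"
    by (intro sum.cong refl) (auto simp: orth)
  also have "\<dots> = A $$ (s, r) * of_nat d ^ n" using rs by simp
  finally show "A $$ (s, r) = 0\<^sub>m ?N ?N $$ (s, r)" using rs d by simp
qed (use A in auto)

text \<open>At \<open>k = d\<close> all labels reduce to 0, which yields the scalar power required
  by \<open>weyl_system\<close>.\<close>

lemma Weyl_pow:
  assumes d: "d > 0"
  shows "\<exists>c. cmod c = 1 \<and> Weyl d n x ^\<^sub>m k
    = c \<cdot>\<^sub>m Weyl d n ((\<lambda>j. (k * fst x j) mod d), (\<lambda>j. (k * snd x j) mod d))"
proof (induction k)
  case 0
  then show ?case using Weyl_zero[OF d] by (intro exI[of _ 1]) simp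
next
  case (Suc k)
  let ?y = "\<lambda>k. ((\<lambda>j. (k * fst x j) mod d), (\<lambda>j. (k * snd x j) mod d))"
  obtain c where c: "cmod c = 1" "Weyl d n x ^\<^sub>m k = c \<cdot>\<^sub>m Weyl d n (?y k)" using Suc by blast
  have y: "vadd d (?y k) x = ?y (Suc k)" by (simp add: vadd_def mod_simps add.commute)
  obtain c' where c': "cmod c' = 1" "Weyl d n (?y k) * Weyl d n x = c' \<cdot>\<^sub>m Weyl d n (vadd d (?y k) x)"
    using Weyl_mult[OF d] by blast
  have "Weyl d n x ^\<^sub>m Suc k = (c * c') \<cdot>\<^sub>m Weyl d n (?y (Suc k))"
    using c(2) c'(2) unfolding y by (simp add: mult_smult_assoc_mat[of _ "d ^ n" "d ^ n" _ "d ^ n"] smult_smult_mat)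
  then show ?case using c(1) c'(1) by (intro exI[of _ "c * c'"]) (simp add: norm_mult)
qed

lemma weyl_system_Weyl:
  assumes d: "d > 0"
  shows "weyl_system (d ^ n) d (Vn d n) (vadd d) ((\<lambda>_. 0), (\<lambda>_. 0)) (Weyl d n)"
proof
  show "\<exists>c. cmod c = 1 \<and> Weyl d n x ^\<^sub>m d = c \<cdot>\<^sub>m 1\<^sub>m (d ^ n)" for x
    using Weyl_pow[OF d, of n x d] Weyl_zero[OF d, of n] by simp
  show "y = z" if "x \<in> Vn d n" "y \<in> Vn d n" "z \<in> Vn d n" "vadd d x y = vadd d x z" for x y z
  proof -
    have "fst y j = fst z j" "snd y j = snd z j" for j
    proof -
      have e: "(fst x j + fst y j) mod d = (fst x j + fst z j) mod d"
          "(snd x j + snd y j) mod d = (snd x j + snd z j) mod d"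
        using that(4) by (auto simp: vadd_def fun_eq_iff)
      have "fst y j < d" "fst z j < d" "snd y j < d" "snd z j < d"
        using that(2,3) d by (cases "j < n"; auto simp: Vn_def)+
      then show "fst y j = fst z j" "snd y j = snd z j"
        using e mod_add_left_cancel_less by blast+
    qed
    then show ?thesis by (simp add: prod_eq_iff fun_eq_iff)
  qed
  show "finite (Vn d n)" by (rule finite_Vn)
  show "\<exists>c. cmod c = 1 \<and> Weyl d n x * Weyl d n y = c \<cdot>\<^sub>m Weyl d n (vadd d x y)" for x y
    by (rule Weyl_mult[OF d])
  show "tr (Weyl d n x) = 0" if "x \<in> Vn d n" "x \<noteq> ((\<lambda>_. 0), (\<lambda>_. 0))" for x
    by (rule tr_Weyl[OF d that])
qed (use d in \<open>auto simp: Weyl_unitary Weyl_zero vadd_def add.commute Vn_def[of d n]\<close>)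

section \<open>The mean state\<close>

text \<open>For a projection the trace is both the rank and the squared Hilbert-Schmidt
  norm.\<close>

lemma projection_rank_pos:
  assumes P: "P \<in> carrier_mat n n" "projection P" "P \<noteq> 0\<^sub>m n n"
  shows "mat_rank n P > 0"
proof (rule ccontr)
  assume "\<not> ?thesis"
  then have "tr P = 0" using rank_projection[OF P(1,2)] by simp
  then have "tr (P * mat_adjoint P) = 0" using P(2) by (simp add: projection_def)
  then show False using tr_self_adjoint_eq_0[OF P(1)] P(3) by simp
qed

definition neg_V :: "nat \<Rightarrow> (nat \<Rightarrow> nat) \<times> (nat \<Rightarrow> nat) \<Rightarrow> (nat \<Rightarrow> nat) \<times> (nat \<Rightarrow> nat)" where
  "neg_V d x = (vneg d (fst x), vneg d (snd x))"

lemma neg_V_in: "d > 0 \<Longrightarrow> x \<in> Vn d n \<Longrightarrow> neg_V d x \<in> Vn d n"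
  by (auto simp: neg_V_def vneg_def Vn_def)

lemma neg_V_neg_V:
  assumes "d > 0" "x \<in> Vn d n"
  shows "neg_V d (neg_V d x) = x"
proof -
  have "(d - (d - a) mod d) mod d = a" if "a < d" for a
    using that by (cases "a = 0") auto
  moreover have "fst x j < d" "snd x j < d" for j
    using assms by (cases "j < n"; auto simp: Vn_def)+
  ultimately show ?thesis by (simp add: neg_V_def vneg_def prod_eq_iff fun_eq_iff)
qed

lemma charfun_eq: "charfun d n \<sigma> x = tr (\<sigma> * Weyl d n (neg_V d x))"
  by (simp add: charfun_def Weyl_def neg_V_def)

text \<open>The description by \<open>THE\<close> needs uniqueness, obtained by applying
  \<open>Weyl_complete\<close> to a difference. Negation is an involution of \<open>Vn\<close>, so
  the condition may be tested at \<open>y\<close> instead of its negative.\<close>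

lemma mean_state_eqI:
  assumes d: "d > 0" and M: "M \<in> carrier_mat (d ^ n) (d ^ n)"
    and tr_M: "\<And>y. y \<in> Vn d n \<Longrightarrow> tr (M * Weyl d n y)
      = (if cmod (tr (\<rho> * Weyl d n y)) = 1 then tr (\<rho> * Weyl d n y) else 0)"
  shows "mean_state d n \<rho> = M"
  unfolding mean_state_def
proof (rule the_equality)
  show "M \<in> carrier_mat (d ^ n) (d ^ n) \<and> (\<forall>x\<in>Vn d n. charfun d n M x =
      (if cmod (charfun d n \<rho> x) = 1 then charfun d n \<rho> x else 0))"
    using M tr_M neg_V_in[OF d] by (simp add: charfun_eq)
next
  fix \<sigma> assume \<sigma>: "\<sigma> \<in> carrier_mat (d ^ n) (d ^ n) \<and> (\<forall>x\<in>Vn d n. charfun d n \<sigma> x =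
      (if cmod (charfun d n \<rho> x) = 1 then charfun d n \<rho> x else 0))"
  let ?N = "d ^ n"
  have "tr ((\<sigma> - M) * Weyl d n y) = 0" if y: "y \<in> Vn d n" for y
  proof -
    have "tr (\<sigma> * Weyl d n y) = tr (M * Weyl d n y)"
      using \<sigma> tr_M[OF y] neg_V_in[OF d y] neg_V_neg_V[OF d y] by (auto simp: charfun_eq)
    then show ?thesis
      using \<sigma> M by (simp add: minus_mult_distrib_mat[of _ ?N ?N _ _ ?N] tr_minus[of _ ?N]
          mult_carrier_mat[of _ ?N ?N _ ?N])
  qed
  then have z: "\<sigma> - M = 0\<^sub>m ?N ?N"
    using \<sigma> M by (intro Weyl_complete[OF d]) (auto simp: minus_carrier_mat[of _ ?N ?N])
  show "\<sigma> = M"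
  proof (rule eq_matI)
    fix i j assume "i < dim_row M" "j < dim_col M"
    then show "\<sigma> $$ (i, j) = M $$ (i, j)"
      using arg_cong[OF z, of "\<lambda>A. A $$ (i, j)"] \<sigma> M by simp
  qed (use \<sigma> M in auto)
qed

theorem mainTheorem2:
  fixes d n :: nat and \<rho> :: "complex mat" and \<alpha> :: ereal
  assumes "prime d" and "n \<ge> 1" and "density (d ^ n) \<rho>" and "\<alpha> \<ge> 1"
  shows "MSPS d n (mean_state d n \<rho>)
    \<and> (\<forall>\<sigma>. MSPS d n \<sigma> \<longrightarrow> D_renyi \<alpha> \<rho> (mean_state d n \<rho>) \<le> D_renyi \<alpha> \<rho> \<sigma>)
    \<and> D_renyi \<alpha> \<rho> (mean_state d n \<rho>) = ereal (H_renyi \<alpha> (mean_state d n \<rho>) - H_renyi \<alpha> \<rho>)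
    \<and> (\<forall>\<sigma>. MSPS d n \<sigma> \<and> \<sigma> \<noteq> mean_state d n \<rho> \<longrightarrow>
         D_renyi \<alpha> \<rho> (mean_state d n \<rho>) < D_renyi \<alpha> \<rho> \<sigma>)"
proof -
  let ?N = "d ^ n"
  have d: "d > 0" using assms(1) by (simp add: prime_gt_0_nat)
  then have N: "?N > 0" by simp
  note dens = assms(3)
  have \<rho>_carrier: "\<rho> \<in> carrier_mat ?N ?N" using dens psd_carrier by (auto simp: density_def)
  interpret weyl_system ?N d "Vn d n" "vadd d" "((\<lambda>_. 0), (\<lambda>_. 0))" "Weyl d n"
    by (rule weyl_system_Weyl[OF d])
  have abelian_iff: "abelian S \<longleftrightarrow> abelian_weyl_group d n S" for S
    by (simp add: abelian_def abelian_weyl_group_def)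
  define P where "P = mean_proj \<rho>"
  define r where "r = mat_rank ?N P"
  note P = mean_proj[OF dens, folded P_def, folded r_def]
  have r: "r > 0" unfolding r_def P_def by (rule mean_proj_rank_pos[OF dens])
  have mean: "mean_state d n \<rho> = of_real (1 / real r) \<cdot>\<^sub>m P"
  proof (rule mean_state_eqI[OF d])
    show "tr (of_real (1 / real r) \<cdot>\<^sub>m P * Weyl d n y)
        = (if cmod (tr (\<rho> * Weyl d n y)) = 1 then tr (\<rho> * Weyl d n y) else 0)" if "y \<in> Vn d n" for y
      using tr_mean_proj_W[OF dens that, folded P_def, folded r_def] P(1) r
      by (simp add: sm tr_smult[of _ ?N] mc)
  qed (use P in auto)
  have MSPS_mean: "MSPS d n (mean_state d n \<rho>)"
    unfolding MSPS_def mean using P(3) abelian_stabilizer[OF dens]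
    by (intro exI[of _ "stabilizer \<rho>"] exI[of _ P]) (simp add: abelian_iff r_def)
  have D_mean: "D_renyi \<alpha> \<rho> (mean_state d n \<rho>) = ereal (ln (real r) - H_renyi \<alpha> \<rho>)"
    unfolding mean using r by (intro D_renyi_scaled_projection[OF dens P(1,2,6) _ assms(4) N]) simp
  have H_mean: "H_renyi \<alpha> (mean_state d n \<rho>) = ln (real r)"
    unfolding mean using r P(5) by (intro H_renyi_scaled_projection[OF P(1,2) _ _ assms(4) N]) auto
  \<comment> \<open>Strictness against every other state gives the minimum and its uniqueness at
    once.\<close>
  have strict: "D_renyi \<alpha> \<rho> (mean_state d n \<rho>) < D_renyi \<alpha> \<rho> \<sigma>"
    if msps: "MSPS d n \<sigma>" and ne: "\<sigma> \<noteq> mean_state d n \<rho>" for \<sigma>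
  proof -
    obtain S Q where S: "abelian S" and Q: "minimal_projection ?N (cstar_gen ?N (Weyl d n ` S)) Q"
      and "\<sigma> = (1 / of_nat (mat_rank ?N Q)) \<cdot>\<^sub>m Q"
      using msps unfolding MSPS_def abelian_iff by blast
    then have \<sigma>: "\<sigma> = of_real (1 / real (mat_rank ?N Q)) \<cdot>\<^sub>m Q" by simp
    have WS: "Weyl d n ` S \<subseteq> carrier_mat ?N ?N" by auto
    have Qp: "Q \<in> carrier_mat ?N ?N" "projection Q" "Q \<noteq> 0\<^sub>m ?N ?N"
      using Q star_algebraD(1)[OF star_algebra_cstar_gen[OF WS]]
      by (auto simp: minimal_projection_def)
    define s where "s = mat_rank ?N Q"
    have s: "s > 0" unfolding s_def by (rule projection_rank_pos[OF Qp])
    show ?thesis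
    proof (cases "Q * \<rho> = \<rho>")
      case True
      \<comment> \<open>Equal projections have equal rank and therefore the same normalized
        state.\<close>
      have "Q \<noteq> P" using ne \<sigma> mean by (auto simp: r_def)
      then have "r < s"
        using mean_proj_least[OF dens S Q True] by (simp add: P_def r_def s_def)
      then have "ln (real r) < ln (real s)" using r by simp
      moreover have "D_renyi \<alpha> \<rho> \<sigma> = ereal (ln (real s) - H_renyi \<alpha> \<rho>)"
        unfolding \<sigma> s_def[symmetric]
        using s by (intro D_renyi_scaled_projection[OF dens Qp(1,2) True _ assms(4) N]) simp
      ultimately show ?thesis by (simp add: D_mean)
    next
      case False
      then have "\<not> supp_le \<rho> \<sigma>"
        unfolding \<sigma> s_def[symmetric] using supp_le_scaled_projection[OF Qp(1,2) \<rho>_carrier] s by simp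
      \<comment> \<open>Here the competitor has infinite divergence, while \<open>D_mean\<close> is
        finite.\<close>
      then show ?thesis by (simp add: D_renyi_def[of _ _ \<sigma>] D_mean)
    qed
  qed
  show ?thesis
    using MSPS_mean strict D_mean H_mean by (metis less_imp_le order_refl)
qed

end
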